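(* Let $G$ be a graph on $n$ vertices that belongs to a homogeneous coherent configuration or that is $1$-walk regular, and let $\overline{G}$ be its complement. Then $$\vartheta(G)\,\vartheta(\overline{G}) = n \quad\text{and}\quad \vartheta^-(\overline{G})\,\vartheta^+(G) = n.$$
   Context: Graphs are finite, simple and undirected. $I$ is the identity matrix, $J$ is the all-ones matrix, $\langle M,N\rangle = \operatorname{tr}(MN^* )$, $\circ$ is the Schur (entrywise) product, inequalities $X\ge 0$, $X\circ A\le 0$ are entrywise (in particular the entries involved are real), and $X\succeq 0$ means that $X$ is positive semidefinite (Hermitian, $n\times n$). For a graph $G$ on $n$ vertices with adjacency matrix $A$, the Lovász, Schrijver and Szegedy theta numbers are $$\vartheta(G) = \max\{\langle J, X\rangle : X\circ A = 0,\ \operatorname{tr} X = 1,\ X\succeq 0\},$$ $$\vartheta^-(G) = \max\{\langle J, X\rangle : X\circ A = 0,\ \operatorname{tr} X = 1,\ X\geq 0,\ X\succeq 0\},$$ $$\vartheta^+(G) = \max\{\langle J, X\rangle : X\circ A \leq 0,\ \operatorname{tr} X = 1,\ X\succeq 0\}.$$ A coherent configuration is a finite set of $01$ matrices $\{A_0,\dotsc,A_d\}$ (all $n\times n$) such that: (i) $\sum_{i=0}^d A_i = J$; (ii) for each $i$, if some diagonal entry of $A_i$ is non-zero, then $A_i$ is diagonal; (iii) the set is closed under transposition; (iv) for all $i,j$, $A_iA_j$ is a linear combination of the matrices in the configuration. It is homogeneous if the identity matrix is one of its matrices. A graph belongs to a coherent configuration if its adjacency matrix is a sum of (distinct) matrices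 of the configuration. A graph with adjacency matrix $A$ is $1$-walk regular if for every positive integer $k$ there are constants $a_k$ and $b_k$ such that $A^k\circ I = a_k I$ and $A^k\circ A = b_k A$. *)

theory Defs
  imports "HOL-Analysis.Analysis" "HOL-Library.Complex_Order"
begin

text \<open>
  Matrices have type \<^typ>\<open>complex ^ 'n ^ 'n\<close>. On this type the library's \<open>*\<close>, \<open>1\<close> and \<open>\<le>\<close> are
  entrywise, so they are the Schur product, the all-ones matrix and the entrywise order; the
  matrix product is \<open>**\<close> and the identity matrix is \<open>mat 1\<close>. The order on \<^typ>\<open>complex\<close>
  is the one of \<^theory>\<open>HOL-Library.Complex_Order\<close>: \<open>z \<le> w\<close> requires \<open>Im z = Im w\<close>,
  so \<open>0 \<le> z\<close> and \<open>z \<le> 0\<close> each entail that \<open>z\<close> is real.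
\<close>

type_synonym 'n cmatrix = "complex ^ 'n ^ 'n"

abbreviation schur :: "'n::finite cmatrix \<Rightarrow> 'n cmatrix \<Rightarrow> 'n cmatrix" (infixl "\<circ>\<^sub>S" 70)
  where "X \<circ>\<^sub>S Y \<equiv> X * Y"

abbreviation all_ones :: "'n::finite cmatrix"
  where "all_ones \<equiv> 1"

lemma schur_nth: "(X \<circ>\<^sub>S Y) $ i $ j = X $ i $ j * Y $ i $ j"
  by simp

lemma all_ones_nth: "all_ones $ i $ j = 1"
  by simp

lemma nonneg_matrix_iff: "0 \<le> X \<longleftrightarrow> (\<forall>i j. 0 \<le> X $ i $ j)" for X :: "'n::finite cmatrix"
  by (simp add: less_eq_vec_def)

lemma nonpos_matrix_iff: "X \<le> 0 \<longleftrightarrow> (\<forall>i j. X $ i $ j \<le> 0)" for X :: "'n::finite cmatrix"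
  by (simp add: less_eq_vec_def)

definition smult_matrix :: "complex \<Rightarrow> 'n::finite cmatrix \<Rightarrow> 'n cmatrix" (infixr "*\<^sub>M" 75)
  where "c *\<^sub>M X = (\<chi> i j. c * X $ i $ j)"

definition ctranspose :: "'n::finite cmatrix \<Rightarrow> 'n cmatrix"
  where "ctranspose X = (\<chi> i j. cnj (X $ j $ i))"

definition matrix_inner :: "'n::finite cmatrix \<Rightarrow> 'n cmatrix \<Rightarrow> complex"
  where "matrix_inner M N = trace (M ** ctranspose N)"

text \<open>The library's \<open>^\<close> on \<^typ>\<open>complex ^ 'n ^ 'n\<close> would be the entrywise power.\<close>

primrec matrix_power :: "'n::finite cmatrix \<Rightarrow> nat \<Rightarrow> 'n cmatrix" where
  "matrix_power X 0 = mat 1"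
| "matrix_power X (Suc k) = X ** matrix_power X k"

definition hermitian :: "'n::finite cmatrix \<Rightarrow> bool"
  where "hermitian X \<longleftrightarrow> ctranspose X = X"

definition pos_semidef :: "'n::finite cmatrix \<Rightarrow> bool"
  where "pos_semidef X \<longleftrightarrow>
    hermitian X \<and> (\<forall>v. 0 \<le> (\<Sum>i\<in>UNIV. cnj (v $ i) * (X *v v) $ i))"

text \<open>A graph on \<open>n = CARD('n)\<close> vertices is given by its adjacency relation on the type \<open>'n\<close>.\<close>

definition simple_graph :: "('n::finite \<Rightarrow> 'n \<Rightarrow> bool) \<Rightarrow> bool"
  where "simple_graph G \<longleftrightarrow> symp G \<and> irreflp G"

definition graph_complement :: "('n::finite \<Rightarrow> 'n \<Rightarrow> bool) \<Rightarrow> 'n \<Rightarrow> 'n \<Rightarrow> bool"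
  where "graph_complement G = (\<lambda>u v. u \<noteq> v \<and> \<not> G u v)"

definition adj_matrix :: "('n::finite \<Rightarrow> 'n \<Rightarrow> bool) \<Rightarrow> 'n cmatrix"
  where "adj_matrix G = (\<chi> u v. if G u v then 1 else 0)"

text \<open>
  The inner product with the all-ones matrix is real for Hermitian \<open>X\<close>; the maxima below are
  taken over the real numbers \<open>t\<close> that it attains on the feasible set.
\<close>

definition lovasz_theta :: "('n::finite \<Rightarrow> 'n \<Rightarrow> bool) \<Rightarrow> real"
  where "lovasz_theta G =
    (GREATEST t. \<exists>X. complex_of_real t = matrix_inner all_ones X \<and>
       X \<circ>\<^sub>S adj_matrix G = 0 \<and> trace X = 1 \<and> pos_semidef X)"

definition schrijver_theta :: "('n::finite \<Rightarrow> 'n \<Rightarrow> bool) \<Rightarrow> real"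
  where "schrijver_theta G =
    (GREATEST t. \<exists>X. complex_of_real t = matrix_inner all_ones X \<and>
       X \<circ>\<^sub>S adj_matrix G = 0 \<and> trace X = 1 \<and> 0 \<le> X \<and> pos_semidef X)"

definition szegedy_theta :: "('n::finite \<Rightarrow> 'n \<Rightarrow> bool) \<Rightarrow> real"
  where "szegedy_theta G =
    (GREATEST t. \<exists>X. complex_of_real t = matrix_inner all_ones X \<and>
       X \<circ>\<^sub>S adj_matrix G \<le> 0 \<and> trace X = 1 \<and> pos_semidef X)"

definition zero_one_matrix :: "'n::finite cmatrix \<Rightarrow> bool"
  where "zero_one_matrix X \<longleftrightarrow> (\<forall>i j. X $ i $ j \<in> {0, 1})"

definition diagonal_matrix :: "'n::finite cmatrix \<Rightarrow> bool"
  where "diagonal_matrix X \<longleftrightarrow> (\<forall>i j. i \<noteq> j \<longrightarrow> X $ i $ j = 0)"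

definition coherent_configuration :: "'n::finite cmatrix set \<Rightarrow> bool"
  where "coherent_configuration \<A> \<longleftrightarrow>
    finite \<A> \<and>
    (\<forall>M\<in>\<A>. zero_one_matrix M) \<and>
    (\<Sum>M\<in>\<A>. M) = all_ones \<and>
    (\<forall>M\<in>\<A>. (\<exists>i. M $ i $ i \<noteq> 0) \<longrightarrow> diagonal_matrix M) \<and>
    (\<forall>M\<in>\<A>. transpose M \<in> \<A>) \<and>
    (\<forall>M\<in>\<A>. \<forall>N\<in>\<A>. \<exists>c. M ** N = (\<Sum>K\<in>\<A>. c K *\<^sub>M K))"

definition homogeneous :: "'n::finite cmatrix set \<Rightarrow> bool"
  where "homogeneous \<A> \<longleftrightarrow> mat 1 \<in> \<A>"

definition belongs_to :: "('n::finite \<Rightarrow> 'n \<Rightarrow> bool) \<Rightarrow> 'n cmatrix set \<Rightarrow> bool"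
  where "belongs_to G \<A> \<longleftrightarrow> (\<exists>\<B>\<subseteq>\<A>. adj_matrix G = (\<Sum>M\<in>\<B>. M))"

definition one_walk_regular :: "('n::finite \<Rightarrow> 'n \<Rightarrow> bool) \<Rightarrow> bool"
  where "one_walk_regular G \<longleftrightarrow>
    (\<forall>k::nat. k > 0 \<longrightarrow> (\<exists>a b.
       matrix_power (adj_matrix G) k \<circ>\<^sub>S mat 1 = a *\<^sub>M mat 1 \<and>
       matrix_power (adj_matrix G) k \<circ>\<^sub>S adj_matrix G = b *\<^sub>M adj_matrix G))"

end

theory Submission
  imports Defs
begin

text \<open>
  All four programs are invariant under taking real parts, so real symmetric matrices suffice.
  Call a matrix regular if its diagonal is constant and the all-ones vector is an eigenvector.
  The inequality that bounds the products from above is \<open>weak_duality\<close>: if \<open>X\<close> and \<open>Y\<close> are positive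
  semidefinite of trace one, the product of their entries is non-positive at every off-diagonal
  position, and one of the two is regular, then \<open>\<langle>J, X\<rangle> \<langle>J, Y\<rangle> \<le> n\<close>. Indeed, comparing \<open>\<langle>X, Y\<rangle>\<close>
  with the component of the regular matrix along \<open>J\<close> bounds it from below by
  \<open>\<langle>J, X\<rangle> \<langle>J, Y\<rangle> / n\<^sup>2\<close>, and comparing it with the diagonal bounds it from above by \<open>1 / n\<close>. If \<open>X\<close> is
  feasible for \<open>G\<close> and \<open>Y\<close> for the complement, the condition on the entries holds, for
  \<open>\<vartheta>(G)\<close> with \<open>\<vartheta>\<close> of the complement, and for Szegedy's number of \<open>G\<close> with Schrijver's number of the
  complement.

  Consequently one regular feasible pair with product equal to \<open>n\<close> proves that both its
  members are optimal and proves the identity (\<open>dual_certificate_optimal\<close>). It remains to find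
  such a pair.

  For a 1-walk-regular graph with edges the pair is explicit. With \<open>\<tau>\<close> the least eigenvalue of \<open>A\<close>, one
  member is a multiple of \<open>A - \<tau> I\<close>, and the other a combination of \<open>J\<close> and of a matrix \<open>E\<close> in the
  algebra generated by \<open>A\<close> that lives on the eigenspace of \<open>\<tau>\<close>; 1-walk-regularity makes \<open>E\<close> constant
  on the diagonal and on the edges, so that \<open>J\<close> can cancel it on the edges.

  For a homogeneous coherent configuration, every matrix in its algebra is regular, and the pair
  comes from semidefinite duality inside the algebra (\<open>approximate_strong_duality\<close>). This needs
  that a symmetric matrix \<open>Z\<close> of the algebra is positive semidefinite as soon as it has non-negative
  inner product with the positive semidefinite matrices of the algebra itself; the reason is
  that the algebra contains a matrix that lives on the lowest eigenspace of \<open>Z\<close>.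

  In both cases that matrix comes from \<open>lowest_eigenmatrix\<close>, a dimension count that replaces
  the spectral theorem.
\<close>

section \<open>Real positive semidefinite matrices\<close>

definition real_psd :: "real ^ 'n ^ 'n \<Rightarrow> bool"
  where "real_psd M \<longleftrightarrow> transpose M = M \<and> (\<forall>v. 0 \<le> v \<bullet> (M *v v))"

lemma inner_matrix_vector_eq_sum:
  fixes M :: "real ^ 'n ^ 'n"
  shows "v \<bullet> (M *v w) = (\<Sum>i\<in>UNIV. \<Sum>j\<in>UNIV. v $ i * M $ i $ j * w $ j)"
  by (simp add: inner_vec_def matrix_vector_mult_def sum_distrib_left mult.assoc)

lemma inner_matrix_eq_sum:
  fixes X Y :: "real ^ 'n ^ 'n"
  shows "X \<bullet> Y = (\<Sum>i\<in>UNIV. \<Sum>j\<in>UNIV. X $ i $ j * Y $ i $ j)"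
  by (simp add: inner_vec_def)

lemma symmetric_inner_swap:
  fixes M :: "real ^ 'n ^ 'n"
  assumes "transpose M = M"
  shows "v \<bullet> (M *v w) = w \<bullet> (M *v v)"
  by (metis assms dot_lmul_matrix inner_commute transpose_matrix_vector)

lemma transpose_self_iff: "transpose M = M \<longleftrightarrow> (\<forall>i j. M $ i $ j = M $ j $ i)"
  by (auto simp: transpose_def vec_eq_iff)

lemma real_psd_symD: "real_psd M \<Longrightarrow> M $ i $ j = M $ j $ i"
  by (metis real_psd_def transpose_self_iff)

lemma real_psd_add: "real_psd M \<Longrightarrow> real_psd N \<Longrightarrow> real_psd (M + N)"
  by (auto simp: real_psd_def transpose_self_iff matrix_vector_mult_add_rdistrib inner_add_right)

lemma real_psd_scale: "real_psd M \<Longrightarrow> 0 \<le> c \<Longrightarrow> real_psd (c *\<^sub>R M)"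
  by (auto simp: real_psd_def transpose_self_iff scaleR_matrix_vector_assoc [symmetric])

lemma mat_1_nth: "mat 1 $ i $ j = (if i = j then 1 else 0)"
  by (simp add: mat_def)

lemma real_psd_mat_1: "real_psd (mat 1)"
  by (simp add: real_psd_def transpose_mat)

lemma all_ones_mult_vec: "((1 :: real ^ 'n ^ 'n) *v v) = (\<Sum>i\<in>UNIV. v $ i) *\<^sub>R 1"
  by (simp add: matrix_vector_mult_def vec_eq_iff)

lemma inner_one_vec: "v \<bullet> (1 :: real ^ 'n) = (\<Sum>i\<in>UNIV. v $ i)"
  by (simp add: inner_vec_def)

lemma real_psd_all_ones: "real_psd (1 :: real ^ 'n ^ 'n)"
  by (simp add: real_psd_def transpose_self_iff all_ones_mult_vec inner_one_vec)

lemma real_psd_gram: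
  fixes R :: "real ^ 'n ^ 'n"
  shows "real_psd (transpose R ** R)"
proof -
  have "v \<bullet> ((transpose R ** R) *v v) = (R *v v) \<bullet> (R *v v)" for v
    by (metis dot_lmul_matrix matrix_vector_mul_assoc transpose_matrix_vector transpose_transpose)
  then show ?thesis
    by (simp add: real_psd_def matrix_transpose_mul)
qed

lemma real_psd_diag:
  assumes "real_psd M" shows "0 \<le> M $ i $ i"
proof -
  have "0 \<le> axis i 1 \<bullet> (M *v axis i 1)" using assms by (simp add: real_psd_def)
  then show ?thesis by (simp add: inner_axis' matrix_vector_mult_basis column_def)
qed

text \<open>
  Evaluate the quadratic form at the sum and at the difference of two basis vectors. The bound is
  used twice: a positive semidefinite matrix with zero diagonal vanishes, and positive semidefinite
  matrices of trace one form a bounded set.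
\<close>

lemma real_psd_offdiag:
  assumes "real_psd M" shows "\<bar>M $ i $ j\<bar> \<le> (M $ i $ i + M $ j $ j) / 2"
proof -
  have "0 \<le> (axis i 1 + s *\<^sub>R axis j 1) \<bullet> (M *v (axis i 1 + s *\<^sub>R axis j 1))" for s
    using assms by (simp add: real_psd_def)
  then have *: "0 \<le> M $ i $ i + s * M $ i $ j + s * (M $ j $ i + s * M $ j $ j)" for s
    by (simp add: matrix_vector_right_distrib inner_add_left inner_axis' matrix_vector_mult_basis
        column_def matrix_vector_mult_scaleR algebra_simps)
  show ?thesis
    using *[of 1] *[of "-1"] real_psd_symD[OF assms, of j i] by (simp add: abs_le_iff)
qed

lemma trace_real_psd_pos:
  fixes M :: "real ^ 'n ^ 'n"
  assumes "real_psd M" "M \<noteq> 0" shows "0 < trace M"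
proof (rule ccontr)
  assume "\<not> 0 < trace M"
  moreover have "0 \<le> trace M"
    unfolding trace_def by (intro sum_nonneg) (simp add: real_psd_diag assms)
  ultimately have "(\<Sum>i\<in>UNIV. M $ i $ i) = 0" by (simp add: trace_def)
  then have "M $ i $ i = 0" for i
    by (subst (asm) sum_nonneg_eq_0_iff) (auto simp: real_psd_diag assms)
  then have "M $ i $ j = 0" for i j
    using real_psd_offdiag[OF assms(1), of i j] by simp
  with assms(2) show False by (simp add: vec_eq_iff)
qed

text \<open>
  If \<open>w = M u\<close> were non-zero, the form at \<open>u + e w\<close> would be \<open>2 e \<bar>w\<bar>\<^sup>2 + e\<^sup>2 (w \<bullet> M w)\<close>, and for small
  negative \<open>e\<close> the linear term makes it negative.
\<close>

lemma real_psd_null_vector: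
  fixes M :: "real ^ 'n ^ 'n"
  assumes "real_psd M" "u \<bullet> (M *v u) = 0" shows "M *v u = 0"
proof (rule ccontr)
  assume "M *v u \<noteq> 0"
  define w where "w = M *v u"
  define a where "a = w \<bullet> w"
  define b where "b = w \<bullet> (M *v w)"
  have a: "a > 0" using \<open>M *v u \<noteq> 0\<close> by (simp add: a_def w_def)
  have b: "b \<ge> 0" using assms by (simp add: b_def real_psd_def)
  have "u \<bullet> (M *v w) = a"
    using assms(1) symmetric_inner_swap[of M u w] by (simp add: real_psd_def a_def w_def)
  then have "(u + e *\<^sub>R w) \<bullet> (M *v (u + e *\<^sub>R w)) = 2 * e * a + e * e * b" for e
    using assms(2)
    by (simp add: matrix_vector_right_distrib inner_add_left inner_add_right matrix_vector_mult_scaleR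
        a_def [symmetric] b_def [symmetric] algebra_simps flip: w_def)
  then have *: "0 \<le> 2 * e * a + e * e * b" for e
    using assms(1) by (metis real_psd_def)
  \<comment> \<open>The shift by 1 makes the choice work also when \<open>b = 0\<close>.\<close>
  define e where "e = - a / (1 + b)"
  have "e * (1 + b) = - a" using b by (simp add: e_def)
  moreover have "e < 0" using a b by (simp add: e_def divide_neg_pos)
  moreover have "2 * e * a + e * e * b = e * (2 * a + e * b)" by (simp add: algebra_simps)
  moreover have "2 * a + e * b = a - e" using calculation(1) by (simp add: algebra_simps)
  ultimately have "2 * e * a + e * e * b < 0" using a by (simp add: mult_neg_pos)
  with *[of e] show False by simp
qed

text \<open>
  Positive semidefinite matrices form a self-dual cone. Instead of a spectral decomposition of
  \<open>M\<close>, peel off rank-one terms by Schur complements: if \<open>d = M\<^sub>i\<^sub>i > 0\<close> and \<open>u\<close> is column \<open>i\<close> of \<open>M\<close>,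
  then \<open>M - u u\<^sup>T / d\<close> is again positive semidefinite and has fewer non-zero diagonal entries, while
  \<open>u u\<^sup>T\<close> contributes \<open>u \<bullet> X u \<ge> 0\<close>.
\<close>

lemma inner_real_psd_nonneg:
  fixes X M :: "real ^ 'n ^ 'n"
  assumes X: "real_psd X" and M: "real_psd M"
  shows "0 \<le> X \<bullet> M"
  using M
proof (induction "card {i. M $ i $ i \<noteq> 0}" arbitrary: M rule: less_induct)
  case less
  show ?case
  proof (cases "M = 0")
    case False
    then have "0 < trace M" using less.prems trace_real_psd_pos by blast
    then obtain i where "M $ i $ i \<noteq> 0"
      by (force simp: trace_def intro: ccontr)
    then have d: "0 < M $ i $ i"
      using real_psd_diag[OF less.prems, of i] by simp
    define d where "d = M $ i $ i"
    define u where "u = column i M"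
    define M' where "M' = M - (1 / d) *\<^sub>R (\<chi> j k. u $ j * u $ k)"
    have Mu: "M *v axis i 1 = u" by (simp add: u_def matrix_vector_mult_basis)
    have "d > 0" using d by (simp add: d_def)
    have outer: "(\<chi> j k. u $ j * u $ k) *v v = (u \<bullet> v) *\<^sub>R u" for v :: "real ^ 'n"
      by (simp add: matrix_vector_mult_def vec_eq_iff inner_vec_def sum_distrib_left mult_ac)
    have "0 \<le> v \<bullet> (M' *v v)" for v
    proof -
      \<comment> \<open>The form of the Schur complement at \<open>v\<close> is the form of \<open>M\<close> at \<open>v - s e\<^sub>i\<close> for this \<open>s\<close>.\<close>
      define s where "s = (u \<bullet> v) / d"
      have "u $ i = d" by (simp add: u_def d_def column_def)
      have "axis i 1 \<bullet> (M *v v) = u \<bullet> v"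
        using less.prems Mu symmetric_inner_swap[of M "axis i 1" v]
        by (simp add: real_psd_def inner_commute)
      then have "(v - s *\<^sub>R axis i 1) \<bullet> (M *v (v - s *\<^sub>R axis i 1))
        = v \<bullet> (M *v v) - 2 * s * (u \<bullet> v) + s * s * d"
        using \<open>u $ i = d\<close>
        by (simp add: matrix_vector_mult_diff_distrib inner_diff_left inner_diff_right
            matrix_vector_mult_scaleR Mu inner_axis' inner_commute[of v u] algebra_simps)
      also have "\<dots> = v \<bullet> (M' *v v)"
        using \<open>d > 0\<close>
        by (simp add: M'_def matrix_vector_mult_diff_rdistrib inner_diff_right
            scaleR_matrix_vector_assoc [symmetric] outer s_def inner_commute[of v u] field_simps)
      finally show ?thesis using less.prems by (metis real_psd_def)
    qed
    then have psd': "real_psd M'"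
      using less.prems by (auto simp: real_psd_def transpose_self_iff M'_def mult.commute)
    have le: "M' $ j $ j \<le> M $ j $ j" for j
      using \<open>d > 0\<close> by (simp add: M'_def)
    have "M' $ i $ i = 0"
      using \<open>d > 0\<close> by (simp add: M'_def u_def d_def column_def)
    moreover have "M' $ j $ j = 0" if "M $ j $ j = 0" for j
      using le[of j] real_psd_diag[OF psd', of j] that by simp
    ultimately have "{j. M' $ j $ j \<noteq> 0} \<subset> {j. M $ j $ j \<noteq> 0}"
      using d by force
    then have "0 \<le> X \<bullet> M'"
      using less.hyps psd' by (simp add: psubset_card_mono)
    moreover have "X \<bullet> (\<chi> j k. u $ j * u $ k) = u \<bullet> (X *v u)"
      by (simp add: inner_matrix_eq_sum inner_matrix_vector_eq_sum mult_ac)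
    moreover have "X \<bullet> M = X \<bullet> M' + (1 / d) * (X \<bullet> (\<chi> j k. u $ j * u $ k))"
      by (simp add: M'_def inner_diff_right)
    ultimately show ?thesis
      using X \<open>d > 0\<close> by (simp add: real_psd_def)
  qed simp
qed

section \<open>Weak duality\<close>

text \<open>
  The features of a matrix in a homogeneous coherent algebra that the duality argument uses: the
  trace is spread evenly over the diagonal, and the all-ones vector is an eigenvector.
\<close>

definition regular_matrix :: "real ^ 'n ^ 'n \<Rightarrow> bool"
  where "regular_matrix M \<longleftrightarrow> (\<forall>i j. M $ i $ i = M $ j $ j) \<and> (\<exists>r. M *v 1 = r *\<^sub>R 1)"

lemma all_ones_inner: "(1 :: real ^ 'n ^ 'n) \<bullet> X = (\<Sum>i\<in>UNIV. \<Sum>j\<in>UNIV. X $ i $ j)"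
  by (simp add: inner_matrix_eq_sum)

lemma all_ones_inner_eq_form: "(1 :: real ^ 'n ^ 'n) \<bullet> X = 1 \<bullet> (X *v 1)"
  by (simp add: inner_matrix_eq_sum inner_matrix_vector_eq_sum)

lemma trace_constant_diagonal:
  fixes M :: "real ^ 'n ^ 'n"
  assumes "\<And>i j. M $ i $ i = M $ j $ j"
  shows "trace M = real CARD('n) * M $ i $ i"
proof -
  have "trace M = (\<Sum>j\<in>(UNIV :: 'n set). M $ i $ i)"
    unfolding trace_def using assms by (intro sum.cong) auto
  then show ?thesis by simp
qed

text \<open>
  Since the all-ones vector is an eigenvector of \<open>Y\<close>, with eigenvalue \<open>r\<close>, subtracting the
  component \<open>(r / n) J\<close> leaves \<open>Y\<close> positive semidefinite; so \<open>\<langle>X, Y\<rangle> \<ge> (r / n) \<langle>J, X\<rangle>\<close>, where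
  \<open>r = \<langle>J, Y\<rangle> / n\<close>. On the other side only the diagonal contributes positively to \<open>\<langle>X, Y\<rangle>\<close>, and
  the diagonal of \<open>Y\<close> is constantly \<open>1 / n\<close>, so \<open>\<langle>X, Y\<rangle> \<le> 1 / n\<close>.
\<close>

lemma weak_duality:
  fixes X Y :: "real ^ 'n ^ 'n"
  assumes X: "real_psd X" "trace X = 1" and Y: "real_psd Y" "trace Y = 1" "regular_matrix Y"
    and off: "\<And>i j. i \<noteq> j \<Longrightarrow> X $ i $ j * Y $ i $ j \<le> 0"
  shows "(1 \<bullet> X) * (1 \<bullet> Y) \<le> real CARD('n)"
proof -
  define n where "n = real CARD('n)"
  have n: "n > 0" by (simp add: n_def)
  obtain r where r: "Y *v 1 = r *\<^sub>R 1" using Y(3) by (auto simp: regular_matrix_def)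
  have diag: "Y $ i $ i = 1 / n" for i
    using trace_constant_diagonal[of Y i] Y n by (auto simp: regular_matrix_def n_def field_simps)
  have one: "(1 :: real ^ 'n) \<bullet> 1 = n" by (simp add: inner_one_vec n_def)
  have JY: "1 \<bullet> Y = n * r" by (simp add: all_ones_inner_eq_form r one)
  have "0 \<le> v \<bullet> ((Y - (r / n) *\<^sub>R 1) *v v)" for v
  proof -
    \<comment> \<open>Removing from \<open>v\<close> its mean removes exactly the component of \<open>Y\<close> along the all-ones vector.\<close>
    define m where "m = (v \<bullet> 1) / n"
    have "1 \<bullet> (Y *v v) = r * (v \<bullet> 1)"
      using Y symmetric_inner_swap[of Y 1 v] by (simp add: real_psd_def r)
    then have "(v - m *\<^sub>R 1) \<bullet> (Y *v (v - m *\<^sub>R 1))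
        = v \<bullet> (Y *v v) - 2 * m * r * (v \<bullet> 1) + m * m * r * n"
      by (simp add: matrix_vector_mult_diff_distrib inner_diff_left inner_diff_right
            matrix_vector_mult_scaleR r one algebra_simps)
    also have "\<dots> = v \<bullet> ((Y - (r / n) *\<^sub>R 1) *v v)"
      using n by (simp add: matrix_vector_mult_diff_rdistrib inner_diff_right
            scaleR_matrix_vector_assoc [symmetric] all_ones_mult_vec inner_one_vec m_def field_simps)
    finally show ?thesis using Y(1) by (metis real_psd_def)
  qed
  then have "real_psd (Y - (r / n) *\<^sub>R 1)"
    using Y by (auto simp: real_psd_def transpose_self_iff)
  then have "0 \<le> X \<bullet> (Y - (r / n) *\<^sub>R 1)"
    using X inner_real_psd_nonneg by blast
  then have "(r / n) * (1 \<bullet> X) \<le> X \<bullet> Y"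
    by (simp add: inner_diff_right inner_commute[of X 1])
  also have "X \<bullet> Y \<le> (\<Sum>i\<in>UNIV. \<Sum>j\<in>UNIV. if i = j then X $ i $ i * (1 / n) else 0)"
    unfolding inner_matrix_eq_sum using off diag by (intro sum_mono) auto
  also have "\<dots> = (\<Sum>i\<in>UNIV. X $ i $ i) * (1 / n)"
    by (simp only: sum.delta' finite UNIV_I if_True sum_distrib_right)
  also have "\<dots> = 1 / n"
    using X(2) by (simp add: trace_def)
  finally have "r * (1 \<bullet> X) \<le> 1" using n by (simp add: field_simps)
  then show ?thesis using n by (simp add: JY n_def[symmetric] mult_ac mult_left_le)
qed

section \<open>The lowest eigenspace inside a matrix algebra\<close>

text \<open>
  The minimum of the Rayleigh quotient: it is attained on the unit sphere, and a minimiser is a null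
  vector of the shifted form.
\<close>

lemma lowest_eigenvalue:
  fixes Z :: "real ^ 'n ^ 'n"
  assumes "transpose Z = Z"
  obtains \<tau> u where "u \<noteq> 0" "(Z - \<tau> *\<^sub>R mat 1) *v u = 0" "real_psd (Z - \<tau> *\<^sub>R mat 1)"
proof -
  have "continuous_on (sphere 0 1) (\<lambda>v :: real ^ 'n. v \<bullet> (Z *v v))"
    by (intro continuous_intros linear_continuous_on matrix_vector_mul_bounded_linear)
  moreover have "sphere (0 :: real ^ 'n) 1 \<noteq> {}" by simp
  ultimately obtain u where u: "u \<in> sphere 0 1"
    and min: "\<And>v. v \<in> sphere 0 1 \<Longrightarrow> u \<bullet> (Z *v u) \<le> v \<bullet> (Z *v v)"
    using continuous_attains_inf[OF compact_sphere, of 0 1 "\<lambda>v. v \<bullet> (Z *v v)"] by blast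
  define \<tau> where "\<tau> = u \<bullet> (Z *v u)"
  have form: "v \<bullet> ((Z - \<tau> *\<^sub>R mat 1) *v v) = v \<bullet> (Z *v v) - \<tau> * (v \<bullet> v)" for v
    by (simp add: matrix_vector_mult_diff_rdistrib inner_diff_right scaleR_matrix_vector_assoc [symmetric])
  have "0 \<le> v \<bullet> (Z *v v) - \<tau> * (v \<bullet> v)" for v
  proof (cases "v = 0")
    case False
    define w where "w = (1 / norm v) *\<^sub>R v"
    have v: "v = norm v *\<^sub>R w" "w \<in> sphere 0 1" using False by (auto simp: w_def)
    have "v \<bullet> (Z *v v) = (norm v)\<^sup>2 * (w \<bullet> (Z *v w))"
      by (subst (1 2) v(1))
        (simp only: matrix_vector_mult_scaleR inner_scaleR_left inner_scaleR_right
          power2_eq_square mult_ac)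
    moreover have "\<tau> \<le> w \<bullet> (Z *v w)" using min v by (simp add: \<tau>_def)
    ultimately show ?thesis
      using mult_right_mono[of \<tau> "w \<bullet> (Z *v w)" "(norm v)\<^sup>2"]
      by (simp add: power2_norm_eq_inner [symmetric] mult.commute)
  qed simp
  then have psd: "real_psd (Z - \<tau> *\<^sub>R mat 1)"
    using assms by (auto simp: real_psd_def form transpose_self_iff mat_1_nth)
  have "u \<bullet> u = 1" using u by (simp add: norm_eq_1)
  then have "u \<bullet> ((Z - \<tau> *\<^sub>R mat 1) *v u) = 0"
    unfolding form by (simp add: \<tau>_def)
  then have "(Z - \<tau> *\<^sub>R mat 1) *v u = 0" using psd real_psd_null_vector by blast
  moreover have "u \<noteq> 0" using u by auto
  ultimately show ?thesis using psd that by blast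
qed

definition matrix_star_algebra :: "(real ^ 'n ^ 'n) set \<Rightarrow> bool"
  where "matrix_star_algebra \<P> \<longleftrightarrow> subspace \<P> \<and> mat 1 \<in> \<P> \<and>
    (\<forall>M\<in>\<P>. \<forall>N\<in>\<P>. M ** N \<in> \<P>) \<and> (\<forall>M\<in>\<P>. transpose M \<in> \<P>)"

lemma trace_mult_eq_inner:
  fixes X Y :: "real ^ 'n ^ 'n"
  assumes "transpose X = X"
  shows "trace (X ** Y) = X \<bullet> Y"
proof -
  have "trace (X ** Y) = (\<Sum>i\<in>UNIV. \<Sum>j\<in>UNIV. X $ j $ i * Y $ j $ i)"
    using assms by (simp add: trace_def matrix_matrix_mult_def transpose_self_iff)
  also have "\<dots> = X \<bullet> Y"
    unfolding inner_matrix_eq_sum by (rule sum.swap)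
  finally show ?thesis .
qed

text \<open>
  The matrix \<open>E\<close> stands in for the projection onto the lowest eigenspace of \<open>Z\<close>; the point is that
  it can be found inside the algebra \<open>\<P>\<close>. Right multiplication by the singular matrix
  \<open>W = Z - \<tau> I\<close> maps \<open>\<P>\<close> to itself and misses \<open>I\<close>, so by finiteness of dimension it kills some
  non-zero \<open>R \<in> \<P>\<close>; then \<open>E = R\<^sup>T R\<close> is positive semidefinite and is killed as well.
\<close>

lemma lowest_eigenmatrix:
  fixes Z :: "real ^ 'n ^ 'n"
  assumes \<P>: "matrix_star_algebra \<P>" and Z: "Z \<in> \<P>" "transpose Z = Z"
  obtains \<tau> E where "E \<in> \<P>" "real_psd E" "E \<noteq> 0" "E ** Z = \<tau> *\<^sub>R E"
    "real_psd (Z - \<tau> *\<^sub>R mat 1)"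
proof -
  obtain \<tau> u where u: "u \<noteq> 0" "(Z - \<tau> *\<^sub>R mat 1) *v u = 0" "real_psd (Z - \<tau> *\<^sub>R mat 1)"
    using lowest_eigenvalue[OF Z(2)] by blast
  define W where "W = Z - \<tau> *\<^sub>R mat 1"
  have sub: "subspace \<P>" using \<P> by (simp add: matrix_star_algebra_def)
  have "W \<in> \<P>" unfolding W_def
    using \<P> Z by (auto simp: matrix_star_algebra_def intro!: subspace_diff subspace_scale)
  define f where "f R = R ** W" for R :: "real ^ 'n ^ 'n"
  have lin: "linear f"
    by (rule linearI)
      (simp_all add: f_def matrix_matrix_mult_def vec_eq_iff sum.distrib distrib_right
        sum_distrib_left mult.assoc)
  have f\<P>: "f ` \<P> \<subseteq> \<P>" using \<P> \<open>W \<in> \<P>\<close> by (auto simp: f_def matrix_star_algebra_def)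
  have "mat 1 \<notin> f ` \<P>"
  proof
    assume "mat 1 \<in> f ` \<P>"
    then obtain R where "R ** W = mat 1" by (auto simp: f_def)
    then have "u = R *v (W *v u)" by (simp add: matrix_vector_mul_assoc)
    then show False using u by (simp add: W_def)
  qed
  then have "f ` \<P> \<noteq> \<P>" using \<P> by (auto simp: matrix_star_algebra_def)
  have "\<not> inj_on f \<P>"
  proof
    assume "inj_on f \<P>"
    then have "dim (f ` \<P>) = dim \<P>"
      using dim_image_eq[OF lin] sub by (simp add: span_eq_iff[THEN iffD2])
    then have "f ` \<P> = \<P>"
      using subspace_dim_equal[OF linear_subspace_image[OF lin sub] sub f\<P>] by simp
    with \<open>f ` \<P> \<noteq> \<P>\<close> show False by simp
  qed
  then obtain R where R: "R \<in> \<P>" "R \<noteq> 0" "R ** W = 0"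
    using linear_injective_on_subspace_0[OF lin sub] by (auto simp: f_def)
  define E where "E = transpose R ** R"
  have "E \<in> \<P>" using R \<P> by (simp add: E_def matrix_star_algebra_def)
  moreover have "real_psd E" by (simp add: E_def real_psd_gram)
  moreover have "E \<noteq> 0"
  proof
    assume "E = 0"
    moreover have "trace E = R \<bullet> R"
      unfolding inner_matrix_eq_sum
      by (subst sum.swap) (simp add: E_def trace_def matrix_matrix_mult_def transpose_def)
    ultimately show False using R by (simp add: trace_def)
  qed
  moreover have "E ** W = 0"
    by (simp add: E_def R matrix_mul_assoc [symmetric])
  then have "E ** (W + \<tau> *\<^sub>R mat 1) = \<tau> *\<^sub>R E"
    by (simp add: matrix_add_ldistrib)
      (simp add: vec_eq_iff matrix_matrix_mult_def mat_1_nth if_distrib [of "(*) _"] mult.commute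
        cong: if_cong)
  then have "E ** Z = \<tau> *\<^sub>R E"
    by (simp add: W_def)
  ultimately show ?thesis using u that by blast
qed


section \<open>Dual certificates\<close>

definition real_adj :: "('n \<Rightarrow> 'n \<Rightarrow> bool) \<Rightarrow> real ^ 'n ^ 'n"
  where "real_adj G = (\<chi> i j. if G i j then 1 else 0)"

definition density_matrix :: "real ^ 'n ^ 'n \<Rightarrow> bool"
  where "density_matrix X \<longleftrightarrow> real_psd X \<and> trace X = 1"

text \<open>
  A cone \<open>P\<close> of real numbers treats both pairs of programs at once. For \<open>P = UNIV\<close> the two
  conditions below are the constraints of \<open>\<vartheta>\<close> for \<open>G\<close> and for its complement; for \<open>P = {0..}\<close> they are
  those of Szegedy's number for \<open>G\<close> and of Schrijver's number for the complement, up to the sign of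
  the diagonal, which positive semidefiniteness provides. The first condition puts the entries on
  the edges into the polar cone of \<open>P\<close>.
\<close>

definition edge_polar :: "real set \<Rightarrow> ('n \<Rightarrow> 'n \<Rightarrow> bool) \<Rightarrow> real ^ 'n ^ 'n \<Rightarrow> bool"
  where "edge_polar P G X \<longleftrightarrow> (\<forall>i j. G i j \<longrightarrow> (\<forall>p\<in>P. X $ i $ j * p \<le> 0))"

definition edge_cone :: "real set \<Rightarrow> ('n \<Rightarrow> 'n \<Rightarrow> bool) \<Rightarrow> real ^ 'n ^ 'n \<Rightarrow> bool"
  where "edge_cone P G Y \<longleftrightarrow>
    (\<forall>i j. (G i j \<longrightarrow> Y $ i $ j \<in> P) \<and> (i \<noteq> j \<longrightarrow> \<not> G i j \<longrightarrow> Y $ i $ j = 0))"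

text \<open>
  A pair that attains equality in weak duality. Regularity of both matrices makes weak duality
  applicable to either of them against an arbitrary feasible matrix of the other program, so a
  certificate determines both optimal values.
\<close>

definition dual_certificate ::
  "real set \<Rightarrow> ('n::finite \<Rightarrow> 'n \<Rightarrow> bool) \<Rightarrow> real ^ 'n ^ 'n \<Rightarrow> real ^ 'n ^ 'n \<Rightarrow> bool"
  where "dual_certificate P G X Y \<longleftrightarrow>
    density_matrix X \<and> regular_matrix X \<and> edge_polar P G X \<and>
    density_matrix Y \<and> regular_matrix Y \<and> edge_cone P G Y \<and>
    (1 \<bullet> X) * (1 \<bullet> Y) = real CARD('n)"

lemma edge_weak_duality:
  fixes X Y :: "real ^ 'n ^ 'n"
  assumes "density_matrix X" "edge_polar P G X" "density_matrix Y" "edge_cone P G Y"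
    and "regular_matrix X \<or> regular_matrix Y"
  shows "(1 \<bullet> X) * (1 \<bullet> Y) \<le> real CARD('n)"
proof -
  have "X $ i $ j * Y $ i $ j \<le> 0" if "i \<noteq> j" for i j
    using assms that by (cases "G i j") (auto simp: edge_polar_def edge_cone_def)
  moreover from this have "Y $ i $ j * X $ i $ j \<le> 0" if "i \<noteq> j" for i j
    using that by (simp add: mult.commute)
  ultimately show ?thesis
    using assms weak_duality[of X Y] weak_duality[of Y X]
    by (auto simp: density_matrix_def mult.commute)
qed

lemma density_matrix_inner_nonneg: "density_matrix X \<Longrightarrow> 0 \<le> 1 \<bullet> X"
  by (simp add: density_matrix_def inner_real_psd_nonneg real_psd_all_ones)

lemma dual_certificate_optimal:
  fixes X\<^sub>0 Y\<^sub>0 :: "real ^ 'n ^ 'n"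
  assumes "dual_certificate P G X\<^sub>0 Y\<^sub>0"
  shows "density_matrix X \<Longrightarrow> edge_polar P G X \<Longrightarrow> 1 \<bullet> X \<le> 1 \<bullet> X\<^sub>0"
    and "density_matrix Y \<Longrightarrow> edge_cone P G Y \<Longrightarrow> 1 \<bullet> Y \<le> 1 \<bullet> Y\<^sub>0"
proof -
  have prod: "(1 \<bullet> X\<^sub>0) * (1 \<bullet> Y\<^sub>0) = real CARD('n)"
    using assms by (simp add: dual_certificate_def)
  moreover have "0 \<le> 1 \<bullet> X\<^sub>0" "0 \<le> 1 \<bullet> Y\<^sub>0"
    using assms by (simp_all add: dual_certificate_def density_matrix_inner_nonneg)
  moreover have "1 \<bullet> X\<^sub>0 \<noteq> 0" "1 \<bullet> Y\<^sub>0 \<noteq> 0"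
    using prod by auto
  ultimately have pos: "0 < 1 \<bullet> X\<^sub>0" "0 < 1 \<bullet> Y\<^sub>0" by simp_all
  show "1 \<bullet> X \<le> 1 \<bullet> X\<^sub>0" if "density_matrix X" "edge_polar P G X"
  proof -
    have "(1 \<bullet> X) * (1 \<bullet> Y\<^sub>0) \<le> (1 \<bullet> X\<^sub>0) * (1 \<bullet> Y\<^sub>0)"
      using edge_weak_duality[of X P G Y\<^sub>0] that assms prod by (simp add: dual_certificate_def)
    then show ?thesis using pos by simp
  qed
  show "1 \<bullet> Y \<le> 1 \<bullet> Y\<^sub>0" if "density_matrix Y" "edge_cone P G Y"
  proof -
    have "(1 \<bullet> X\<^sub>0) * (1 \<bullet> Y) \<le> (1 \<bullet> X\<^sub>0) * (1 \<bullet> Y\<^sub>0)"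
      using edge_weak_duality[of X\<^sub>0 P G Y] that assms prod by (simp add: dual_certificate_def)
    then show ?thesis using pos by simp
  qed
qed

section \<open>Certificates for 1-walk-regular graphs\<close>

lemma trace_scaleR: "trace (c *\<^sub>R M) = c * trace (M :: real ^ 'n ^ 'n)"
  by (simp add: trace_def sum_distrib_left)

lemma trace_all_ones: "trace (1 :: real ^ 'n ^ 'n) = real CARD('n)"
  by (simp add: trace_def)

lemma trace_identity: "trace (mat 1 :: real ^ 'n ^ 'n) = real CARD('n)"
  by (simp add: trace_def mat_def)

lemma all_ones_inner_of_row_sum:
  fixes M :: "real ^ 'n ^ 'n"
  assumes "M *v 1 = r *\<^sub>R 1" shows "1 \<bullet> M = r * real CARD('n)"
  by (simp add: all_ones_inner_eq_form assms inner_one_vec)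

text \<open>
  Let \<open>k\<close> be the degree, \<open>\<tau>\<close> the least eigenvalue of the adjacency matrix \<open>A\<close>, and \<open>E\<close> a positive
  semidefinite matrix in the algebra with \<open>E A = \<tau> E\<close>. Then \<open>Y = (A - \<tau> I) / (- n \<tau>)\<close>
  is feasible for the complement of \<open>G\<close>, with value \<open>1 - k / \<tau>\<close>. The entries of \<open>E\<close> on the edges are
  a constant \<open>f\<close>, and \<open>tr (E A) = \<tau> tr E\<close> gives \<open>k f = \<tau> e\<close> with \<open>e\<close> the diagonal entry; so some
  combination \<open>X\<close> of \<open>J\<close> and \<open>E\<close> vanishes on the edges. Since \<open>E\<close> annihilates the all-ones vector, \<open>X\<close>
  has value \<open>n / (1 - k / \<tau>)\<close>, Hoffman's ratio bound. As \<open>X\<close> is zero and \<open>Y\<close> is non-negative on the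
  edges, one pair serves every cone \<open>P\<close> that contains the non-negative reals.
\<close>

lemma constant_on_edges_dual_certificate:
  fixes G :: "'n::finite \<Rightarrow> 'n \<Rightarrow> bool"
  assumes G: "simple_graph G"
    and \<P>: "matrix_star_algebra \<P>" and A\<P>: "real_adj G \<in> \<P>"
    and diag: "\<And>M i j. M \<in> \<P> \<Longrightarrow> M $ i $ i = M $ j $ j"
    and edge: "\<And>M i j k l. M \<in> \<P> \<Longrightarrow> G i j \<Longrightarrow> G k l \<Longrightarrow> M $ i $ j = M $ k $ l"
    and P: "{0..} \<subseteq> P"
  shows "\<exists>X Y. dual_certificate P G X Y"
proof -
  define A where "A = real_adj G"
  define n where "n = real CARD('n)"
  have n: "n > 0" by (simp add: n_def)
  have A_nth: "A $ i $ j = (if G i j then 1 else 0)" for i j by (simp add: A_def real_adj_def)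
  have sym: "G i j \<longleftrightarrow> G j i" and irr: "\<not> G i i" for i j
    using G by (auto simp: simple_graph_def symp_def irreflp_def)
  have A_sym: "transpose A = A" by (auto simp: transpose_self_iff A_nth sym)
  have J1: "(1 :: real ^ 'n ^ 'n) *v 1 = n *\<^sub>R 1"
    by (simp add: all_ones_mult_vec n_def)
  show ?thesis
  proof (cases "A = 0")
    case True
    then have noedge: "\<not> G i j" for i j
      using A_nth[of i j] by (auto split: if_splits)
    \<comment> \<open>The edgeless graph has \<open>\<tau> = k = 0\<close>, so that the formulas below do not apply.\<close>
    have "dual_certificate P G ((1 / n) *\<^sub>R 1) ((1 / n) *\<^sub>R mat 1)"
      using n noedge
      by (auto simp: dual_certificate_def density_matrix_def real_psd_scale real_psd_all_ones
          real_psd_mat_1 regular_matrix_def edge_polar_def edge_cone_def mat_1_nth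
          scaleR_matrix_vector_assoc [symmetric] J1 trace_scaleR trace_all_ones trace_identity
          all_ones_inner n_def [symmetric] intro: exI [of _ 1])
    then show ?thesis by blast
  next
    case False
    obtain \<tau> E where E: "E \<in> \<P>" "real_psd E" "E \<noteq> 0" "E ** A = \<tau> *\<^sub>R E"
      and psd: "real_psd (A - \<tau> *\<^sub>R mat 1)"
      using lowest_eigenmatrix[OF \<P> A\<P>] A_sym unfolding A_def by blast
    have trA: "trace A = 0" by (simp add: trace_def A_nth irr)
    have "A \<noteq> \<tau> *\<^sub>R mat 1"
    proof
      assume eq: "A = \<tau> *\<^sub>R mat 1"
      then have "A $ i $ i = \<tau>" for i by (simp add: mat_def)
      then have "\<tau> = 0" by (simp add: A_nth irr)
      with eq False show False by simp
    qed
    then have "0 < trace (A - \<tau> *\<^sub>R mat 1)"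
      using psd trace_real_psd_pos by fastforce
    then have "\<tau> < 0"
      using n trA by (simp add: trace_sub trace_scaleR trace_identity n_def[symmetric] mult_less_0_iff)
    obtain i\<^sub>0 j\<^sub>0 where ij: "G i\<^sub>0 j\<^sub>0"
      using False A_nth by (fastforce simp: vec_eq_iff split: if_splits)
    define k where "k = (A ** A) $ i\<^sub>0 $ i\<^sub>0"
    define e where "e = E $ i\<^sub>0 $ i\<^sub>0"
    define f where "f = E $ i\<^sub>0 $ j\<^sub>0"
    \<comment> \<open>The diagonal of \<open>A\<^sup>2\<close> holds the degrees, which makes \<open>G\<close> regular.\<close>
    have sq: "(A ** A) $ i $ i = (\<Sum>j\<in>UNIV. A $ i $ j)" for i
      unfolding matrix_matrix_mult_def by (auto simp: A_nth sym intro!: sum.cong)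
    have "A ** A \<in> \<P>" using \<P> A\<P> by (simp add: A_def matrix_star_algebra_def)
    then have row: "(\<Sum>j\<in>UNIV. A $ i $ j) = k" for i
      using diag[of "A ** A" i i\<^sub>0] sq by (simp add: k_def)
    have "A $ i\<^sub>0 $ j\<^sub>0 \<le> k"
      unfolding row[of i\<^sub>0, symmetric] by (rule member_le_sum) (auto simp: A_nth)
    then have "k > 0" using ij by (simp add: A_nth)
    have A1: "A *v 1 = k *\<^sub>R 1"
      using row by (simp add: matrix_vector_mult_def vec_eq_iff)
    have trE: "trace E = n * e"
      using trace_constant_diagonal[of E i\<^sub>0] diag E(1) by (simp add: n_def e_def)
    have "e > 0" using trace_real_psd_pos[OF E(2,3)] n trE by (simp add: zero_less_mult_iff)
    have "A \<bullet> E = (\<Sum>i\<in>UNIV. \<Sum>j\<in>UNIV. A $ i $ j * f)"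
      unfolding inner_matrix_eq_sum
      using edge[OF E(1) _ ij] by (intro sum.cong) (auto simp: A_nth f_def)
    also have "\<dots> = n * k * f"
      by (simp add: row n_def flip: sum_distrib_right)
    finally have "trace (E ** A) = n * k * f"
      using trace_mult_eq_inner[OF A_sym, of E] by (simp add: trace_mul_sym[of E])
    then have kf: "k * f = \<tau> * e"
      using n trE by (simp add: E(4) trace_scaleR)
    have "k *\<^sub>R (E *v 1) = \<tau> *\<^sub>R (E *v 1)"
      using E(4) by (metis A1 matrix_vector_mul_assoc matrix_vector_mult_scaleR scaleR_matrix_vector_assoc)
    then have E1: "E *v 1 = 0" using \<open>k > 0\<close> \<open>\<tau> < 0\<close> by simp
    define X where "X = (- \<tau> / (n * (k - \<tau>))) *\<^sub>R 1 + (k / (n * e * (k - \<tau>))) *\<^sub>R E"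
    define Y where "Y = (- 1 / (n * \<tau>)) *\<^sub>R (A - \<tau> *\<^sub>R mat 1)"
    have X1: "X *v 1 = (- \<tau> / (k - \<tau>)) *\<^sub>R 1"
      using n unfolding X_def matrix_vector_mult_add_rdistrib scaleR_matrix_vector_assoc [symmetric] E1 J1
      by simp
    have Y1: "Y *v 1 = ((\<tau> - k) / (n * \<tau>)) *\<^sub>R 1"
      unfolding Y_def scaleR_matrix_vector_assoc [symmetric] matrix_vector_mult_diff_rdistrib A1
        matrix_vector_mul_lid scaleR_diff_left [symmetric] scaleR_scaleR
      by (simp add: diff_divide_distrib)
    have "density_matrix X"
      unfolding density_matrix_def
    proof
      show "real_psd X" unfolding X_def
        using n \<open>k > 0\<close> \<open>\<tau> < 0\<close> \<open>e > 0\<close>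
        by (intro real_psd_add real_psd_scale real_psd_all_ones E) (auto intro!: divide_nonpos_nonneg)
      have "trace X = (- \<tau> / (n * (k - \<tau>))) * n + (k / (n * e * (k - \<tau>))) * (n * e)"
        unfolding X_def trace_add trace_scaleR trace_all_ones trE n_def [symmetric] ..
      also have "\<dots> = (k - \<tau>) / (k - \<tau>)"
        unfolding diff_divide_distrib using n \<open>e > 0\<close> by simp
      also have "\<dots> = 1" using \<open>k > 0\<close> \<open>\<tau> < 0\<close> by simp
      finally show "trace X = 1" .
    qed
    moreover have "regular_matrix X"
    proof -
      have "X $ i $ i = X $ j $ j" for i j
        using diag[OF E(1), of i j] by (simp add: X_def)
      with X1 show ?thesis unfolding regular_matrix_def by blast
    qed
    moreover have "edge_polar P G X"
    proof -
      have "X $ i $ j = 0" if "G i j" for i j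
      proof -
        have "X $ i $ j = (- \<tau> * e + k * f) / (n * e * (k - \<tau>))"
          using edge[OF E(1) that ij] \<open>e > 0\<close> n
          by (simp add: X_def f_def add_divide_distrib diff_divide_distrib)
        then show ?thesis by (simp add: kf)
      qed
      then show ?thesis by (simp add: edge_polar_def)
    qed
    moreover have "density_matrix Y"
      unfolding density_matrix_def
    proof
      show "real_psd Y" unfolding Y_def
        using n \<open>\<tau> < 0\<close> by (intro real_psd_scale psd) (simp add: divide_le_0_iff mult_le_0_iff)
      show "trace Y = 1"
        unfolding Y_def trace_scaleR trace_sub trA trace_identity n_def [symmetric]
        using n \<open>\<tau> < 0\<close> by simp
    qed
    moreover have "regular_matrix Y"
    proof -
      have "Y $ i $ i = Y $ j $ j" for i j
        by (simp add: Y_def A_nth irr mat_1_nth)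
      with Y1 show ?thesis unfolding regular_matrix_def by blast
    qed
    moreover have "edge_cone P G Y"
    proof -
      have "0 \<le> - 1 / (n * \<tau>)"
        using n \<open>\<tau> < 0\<close> by (simp add: divide_le_0_iff mult_le_0_iff)
      then have "- 1 / (n * \<tau>) \<in> P" using P by blast
      then show ?thesis using irr by (auto simp: edge_cone_def Y_def A_nth mat_1_nth)
    qed
    moreover have "(1 \<bullet> X) * (1 \<bullet> Y) = n"
      unfolding all_ones_inner_of_row_sum[OF X1] all_ones_inner_of_row_sum[OF Y1] n_def [symmetric]
      using n \<open>k > 0\<close> \<open>\<tau> < 0\<close> by (simp add: field_simps)
    ultimately show ?thesis
      unfolding dual_certificate_def n_def by blast
  qed
qed

primrec walk_matrix :: "('n::finite \<Rightarrow> 'n \<Rightarrow> bool) \<Rightarrow> nat \<Rightarrow> real ^ 'n ^ 'n" where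
  "walk_matrix G 0 = mat 1"
| "walk_matrix G (Suc k) = real_adj G ** walk_matrix G k"

lemma walk_matrix_add: "walk_matrix G (k + l) = walk_matrix G k ** walk_matrix G l"
  by (induction k) (simp_all add: matrix_mul_assoc)

lemma walk_matrix_sym:
  assumes "transpose (real_adj G) = real_adj G"
  shows "transpose (walk_matrix G k) = walk_matrix G k"
proof (induction k)
  case (Suc k)
  have "walk_matrix G (Suc k) = walk_matrix G (k + 1)" by simp
  then have "walk_matrix G (Suc k) = walk_matrix G k ** real_adj G"
    by (simp only: walk_matrix_add) simp
  with Suc assms show ?case by (simp add: matrix_transpose_mul)
qed (simp add: transpose_mat)

lemma complex_walk_matrix:
  "matrix_power (adj_matrix G) k $ i $ j = complex_of_real (walk_matrix G k $ i $ j)"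
  by (induction k arbitrary: i j)
    (auto simp: mat_def matrix_matrix_mult_def adj_matrix_def real_adj_def intro!: sum.cong)

text \<open>
  The powers of the adjacency matrix are symmetric and closed under products, so their span is the
  algebra in which the previous construction takes place.
\<close>

lemma matrix_star_algebra_walks:
  assumes "transpose (real_adj G) = real_adj G"
  shows "matrix_star_algebra (span (range (walk_matrix G)))"
proof -
  let ?\<P> = "span (range (walk_matrix G))"
  have linL: "linear (\<lambda>M. M ** N)" and linR: "linear (\<lambda>N. M ** N)" for M N :: "real ^ 'n ^ 'n"
    by (rule linearI; simp add: matrix_matrix_mult_def vec_eq_iff sum.distrib algebra_simps sum_distrib_left)+
  have linT: "linear (transpose :: real ^ 'n ^ 'n \<Rightarrow> _)"
    by (rule linearI) (simp_all add: transpose_def vec_eq_iff)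
  have "M ** walk_matrix G l \<in> ?\<P>" if "M \<in> ?\<P>" for M l
  proof -
    have "?\<P> \<subseteq> {M. M ** walk_matrix G l \<in> ?\<P>}"
      by (rule span_minimal)
        (auto simp: walk_matrix_add [symmetric] span_base intro!: linear_subspace_linear_preimage linL)
    with that show ?thesis by blast
  qed
  moreover have "M ** N \<in> ?\<P>" if "M \<in> ?\<P>" "N \<in> ?\<P>" for M N
  proof -
    have "?\<P> \<subseteq> {N. M ** N \<in> ?\<P>}"
      using calculation that by (intro span_minimal linear_subspace_linear_preimage linR) auto
    with that show ?thesis by blast
  qed
  moreover have "transpose M \<in> ?\<P>" if "M \<in> ?\<P>" for M
  proof -
    have "?\<P> \<subseteq> {M. transpose M \<in> ?\<P>}"
      by (rule span_minimal)
        (auto simp: walk_matrix_sym[OF assms] span_base intro!: linear_subspace_linear_preimage linT)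
    with that show ?thesis by blast
  qed
  moreover have "mat 1 \<in> ?\<P>" by (metis span_base rangeI walk_matrix.simps(1))
  ultimately show ?thesis by (simp add: matrix_star_algebra_def)
qed

lemma span_equal_entries:
  fixes M :: "real ^ 'n ^ 'n"
  assumes "M \<in> span B" and "\<And>N. N \<in> B \<Longrightarrow> N $ i $ j = N $ k $ l"
  shows "M $ i $ j = M $ k $ l"
proof -
  have "subspace {N :: real ^ 'n ^ 'n. N $ i $ j = N $ k $ l}"
    by (simp add: subspace_def)
  then have "span B \<subseteq> {N. N $ i $ j = N $ k $ l}"
    using assms(2) by (intro span_minimal) auto
  with assms(1) show ?thesis by blast
qed

text \<open>
  The conditions of 1-walk-regularity hold for each power of the adjacency matrix, and they are
  linear, so they extend to the span of the powers.
\<close>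

lemma one_walk_regular_dual_certificate:
  fixes G :: "'n::finite \<Rightarrow> 'n \<Rightarrow> bool"
  assumes G: "simple_graph G" and walk: "one_walk_regular G" and P: "{0..} \<subseteq> P"
  shows "\<exists>X Y. dual_certificate P G X Y"
proof -
  let ?\<P> = "span (range (walk_matrix G))"
  have sym: "transpose (real_adj G) = real_adj G" and irr: "\<And>i. \<not> G i i"
    using G by (auto simp: transpose_self_iff real_adj_def simple_graph_def symp_def irreflp_def)
  have walk_entries: "(\<forall>i j. walk_matrix G m $ i $ i = walk_matrix G m $ j $ j) \<and>
      (\<forall>i j k l. G i j \<longrightarrow> G k l \<longrightarrow> walk_matrix G m $ i $ j = walk_matrix G m $ k $ l)" for m
  proof (cases "m = 0")
    case True
    then show ?thesis using irr by (auto simp: mat_def)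
  next
    case False
    then have "\<exists>a b. matrix_power (adj_matrix G) m \<circ>\<^sub>S mat 1 = a *\<^sub>M mat 1 \<and>
        matrix_power (adj_matrix G) m \<circ>\<^sub>S adj_matrix G = b *\<^sub>M adj_matrix G"
      using walk unfolding one_walk_regular_def by blast
    then obtain a b where a: "matrix_power (adj_matrix G) m \<circ>\<^sub>S mat 1 = a *\<^sub>M mat 1"
      and b: "matrix_power (adj_matrix G) m \<circ>\<^sub>S adj_matrix G = b *\<^sub>M adj_matrix G"
      by blast
    have "complex_of_real (walk_matrix G m $ i $ i) = a" for i
      using arg_cong[OF a, of "\<lambda>M. M $ i $ i"]
      by (simp add: complex_walk_matrix smult_matrix_def mat_def)
    moreover have "complex_of_real (walk_matrix G m $ i $ j) = b" if "G i j" for i j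
      using arg_cong[OF b, of "\<lambda>M. M $ i $ j"] that
      by (simp add: complex_walk_matrix smult_matrix_def) (simp add: adj_matrix_def)
    ultimately have "complex_of_real (walk_matrix G m $ i $ i) = complex_of_real (walk_matrix G m $ j $ j)"
      and "G i j \<Longrightarrow> G k l \<Longrightarrow>
        complex_of_real (walk_matrix G m $ i $ j) = complex_of_real (walk_matrix G m $ k $ l)"
      for i j k l by simp_all
    then show ?thesis unfolding of_real_eq_iff by blast
  qed
  have "M $ i $ i = M $ j $ j" if "M \<in> ?\<P>" for M i j
    using that
  proof (rule span_equal_entries)
    fix N assume "N \<in> range (walk_matrix G)"
    then show "N $ i $ i = N $ j $ j" using walk_entries by blast
  qed
  moreover have "M $ i $ j = M $ k $ l" if "M \<in> ?\<P>" "G i j" "G k l" for M i j k l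
    using that(1)
  proof (rule span_equal_entries)
    fix N assume "N \<in> range (walk_matrix G)"
    then show "N $ i $ j = N $ k $ l" using walk_entries that(2,3) by blast
  qed
  moreover have "real_adj G \<in> ?\<P>"
  proof -
    have "walk_matrix G 1 \<in> ?\<P>" by (intro span_base rangeI)
    then show ?thesis by simp
  qed
  ultimately show ?thesis
    using constant_on_edges_dual_certificate[OF G matrix_star_algebra_walks[OF sym] _ _ _ P] by blast
qed


section \<open>Strong duality in the algebra of a homogeneous coherent configuration\<close>

text \<open>
  A coherent configuration is a colouring \<open>c\<close> of the ordered pairs of vertices, a pair having as its
  colour the matrix that is non-zero there. Its algebra, with real coefficients, is the set of
  matrices that are constant on colour classes; this form gives entries directly, and needs no
  coefficients.
\<close>

definition colour_algebra :: "('n::finite \<Rightarrow> 'n \<Rightarrow> 'c) \<Rightarrow> (real ^ 'n ^ 'n) set"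
  where "colour_algebra c = {M. \<forall>i j k l. c i j = c k l \<longrightarrow> M $ i $ j = M $ k $ l}"

lemma colour_algebraD: "M \<in> colour_algebra c \<Longrightarrow> c i j = c k l \<Longrightarrow> M $ i $ j = M $ k $ l"
  unfolding colour_algebra_def by blast

lemma colour_algebraI: "(\<And>i j k l. c i j = c k l \<Longrightarrow> M $ i $ j = M $ k $ l) \<Longrightarrow> M \<in> colour_algebra c"
  unfolding colour_algebra_def by blast

text \<open>
  Homogeneity enters as the two conditions on the diagonal, which is a single colour class.
\<close>

locale homogeneous_colouring =
  fixes c :: "'n::finite \<Rightarrow> 'n \<Rightarrow> 'c"
  assumes colour_transpose: "c i j = c k l \<Longrightarrow> c j i = c l k"
    and colour_diagonal: "c i i = c k k"
    and colour_off_diagonal: "c i i = c k l \<Longrightarrow> k = l"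
    and colour_mult: "M \<in> colour_algebra c \<Longrightarrow> N \<in> colour_algebra c \<Longrightarrow> M ** N \<in> colour_algebra c"
begin

abbreviation "\<C> \<equiv> colour_algebra c"

lemma mat_1_colour: "mat 1 \<in> \<C>"
proof (rule colour_algebraI)
  fix i j k l assume "c i j = c k l"
  then have "i = j \<longleftrightarrow> k = l" by (metis colour_diagonal colour_off_diagonal)
  then show "(mat 1 :: real ^ 'n ^ 'n) $ i $ j = mat 1 $ k $ l" by (simp add: mat_1_nth)
qed

lemma all_ones_colour: "1 \<in> \<C>"
  by (simp add: colour_algebra_def)

lemma subspace_colour: "subspace \<C>"
proof (rule subspaceI)
  fix M N :: "real ^ 'n ^ 'n" and r :: real
  assume M: "M \<in> \<C>"
  show "r *\<^sub>R M \<in> \<C>"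
  proof (rule colour_algebraI)
    fix i j k l assume "c i j = c k l"
    from colour_algebraD[OF M this] show "(r *\<^sub>R M) $ i $ j = (r *\<^sub>R M) $ k $ l" by simp
  qed
  assume N: "N \<in> \<C>"
  show "M + N \<in> \<C>"
  proof (rule colour_algebraI)
    fix i j k l assume "c i j = c k l"
    from colour_algebraD[OF M this] colour_algebraD[OF N this]
    show "(M + N) $ i $ j = (M + N) $ k $ l" by simp
  qed
qed (simp add: colour_algebra_def)

lemma matrix_star_algebra_colour: "matrix_star_algebra \<C>"
proof -
  have "transpose M \<in> \<C>" if "M \<in> \<C>" for M
  proof (rule colour_algebraI)
    fix i j k l assume "c i j = c k l"
    from colour_algebraD[OF that colour_transpose[OF this]]
    show "transpose M $ i $ j = transpose M $ k $ l" by (simp add: transpose_def)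
  qed
  then show ?thesis
    using subspace_colour mat_1_colour colour_mult by (simp add: matrix_star_algebra_def)
qed

text \<open>
  The row sums of \<open>M\<close> are the diagonal entries of \<open>M J\<close>, which lies in the algebra.
\<close>

lemma regular_matrix_colour:
  assumes "M \<in> \<C>" shows "regular_matrix M"
proof -
  have "M ** 1 \<in> \<C>" using assms all_ones_colour colour_mult by blast
  then have "(M ** 1) $ i $ i = (M ** 1) $ j $ j" for i j
    using colour_diagonal by (rule colour_algebraD)
  moreover have "(M ** 1) $ i $ i = (M *v 1) $ i" for i
    by (simp add: matrix_matrix_mult_def matrix_vector_mult_def)
  ultimately have "(M *v 1) $ i = (M *v 1) $ j" for i j by metis
  then have "M *v 1 = ((M *v 1) $ undefined) *\<^sub>R 1"
    by (simp add: vec_eq_iff)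
  moreover have "M $ i $ i = M $ j $ j" for i j
    using assms colour_diagonal by (rule colour_algebraD)
  ultimately show ?thesis by (auto simp: regular_matrix_def)
qed

definition colour_densities :: "(real ^ 'n ^ 'n) set"
  where "colour_densities = {Y \<in> \<C>. density_matrix Y}"

lemma closed_colour: "closed \<C>"
  by (rule closed_subspace [OF subspace_colour])

lemma compact_colour_densities: "compact colour_densities"
proof -
  have eq: "colour_densities = \<C> \<inter> {Y. (\<forall>i j. Y $ i $ j = Y $ j $ i)
      \<and> (\<forall>v. 0 \<le> (\<Sum>i\<in>UNIV. \<Sum>j\<in>UNIV. v $ i * Y $ i $ j * v $ j)) \<and> (\<Sum>i\<in>UNIV. Y $ i $ i) = 1}"
    by (auto simp: colour_densities_def density_matrix_def real_psd_def transpose_self_iff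
        inner_matrix_vector_eq_sum trace_def)
  have "closed colour_densities"
    unfolding eq
    by (intro closed_Int closed_colour closed_Collect_conj closed_Collect_all closed_Collect_eq
        closed_Collect_le continuous_intros)
  moreover have "norm Y \<le> real CARD('n)" if "Y \<in> colour_densities" for Y
  proof -
    have Y: "real_psd Y" "trace Y = 1" using that by (simp_all add: colour_densities_def density_matrix_def)
    have le: "Y $ i $ i \<le> trace Y" for i
      unfolding trace_def by (rule member_le_sum) (auto simp: real_psd_diag Y)
    have "\<bar>Y $ i $ j\<bar> \<le> 1" for i j
      using real_psd_offdiag[OF Y(1), of i j] Y(2) le[of i] le[of j] by simp
    then have "Y $ i $ j * Y $ i $ j \<le> 1" for i j
      by (metis abs_square_le_1 power2_eq_square)
    then have "Y \<bullet> Y \<le> (\<Sum>i\<in>(UNIV::'n set). \<Sum>j\<in>(UNIV::'n set). 1)"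
      unfolding inner_matrix_eq_sum by (intro sum_mono)
    then have "(norm Y)\<^sup>2 \<le> (real CARD('n))\<^sup>2"
      by (simp add: power2_norm_eq_inner) (simp add: power2_eq_square)
    then show ?thesis by (rule power2_le_imp_le) simp
  qed
  then have "bounded colour_densities" by (auto simp: bounded_iff)
  ultimately show ?thesis by (simp add: compact_eq_bounded_closed)
qed

lemma convex_colour_densities: "convex colour_densities"
  unfolding convex_def
proof (intro ballI allI impI)
  fix X Y and u v :: real
  assume "X \<in> colour_densities" "Y \<in> colour_densities" "0 \<le> u" "0 \<le> v" "u + v = 1"
  then show "u *\<^sub>R X + v *\<^sub>R Y \<in> colour_densities"
    using subspace_colour
    by (auto simp: colour_densities_def density_matrix_def trace_add trace_scaleR
        intro!: real_psd_add real_psd_scale subspace_add subspace_scale)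
qed

lemma uniform_colour_density: "(1 / real CARD('n)) *\<^sub>R mat 1 \<in> colour_densities"
  using subspace_colour mat_1_colour
  by (simp add: colour_densities_def density_matrix_def trace_scaleR trace_identity
      real_psd_scale real_psd_mat_1 subspace_scale)

text \<open>
  Inside the algebra, too, the cone of positive semidefinite matrices is self-dual: a violation
  would be witnessed by the lowest eigenspace of \<open>Z\<close>, and this witness is available in the algebra.
\<close>

lemma psd_of_nonneg_on_densities:
  assumes Z: "Z \<in> \<C>" "transpose Z = Z" and pos: "\<And>Y. Y \<in> colour_densities \<Longrightarrow> 0 \<le> Z \<bullet> Y"
  shows "real_psd Z"
proof -
  obtain \<tau> E where E: "E \<in> \<C>" "real_psd E" "E \<noteq> 0" "E ** Z = \<tau> *\<^sub>R E"
    and psd: "real_psd (Z - \<tau> *\<^sub>R mat 1)"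
    using lowest_eigenmatrix[OF matrix_star_algebra_colour Z] by blast
  have tr: "0 < trace E" using trace_real_psd_pos E by blast
  then have "(1 / trace E) *\<^sub>R E \<in> colour_densities"
    using E subspace_colour
    by (simp add: colour_densities_def density_matrix_def trace_scaleR real_psd_scale subspace_scale)
  then have "0 \<le> Z \<bullet> ((1 / trace E) *\<^sub>R E)" by (rule pos)
  also have "Z \<bullet> E = \<tau> * trace E"
    using trace_mult_eq_inner[OF Z(2), of E] E(4) by (simp add: trace_mul_sym[of Z] trace_scaleR)
  then have "Z \<bullet> ((1 / trace E) *\<^sub>R E) = \<tau>" using tr by simp
  finally have "real_psd ((Z - \<tau> *\<^sub>R mat 1) + \<tau> *\<^sub>R mat 1)"
    using psd by (intro real_psd_add real_psd_scale real_psd_mat_1)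
  then show ?thesis by simp
qed

definition symmetric_edge_cone :: "real set \<Rightarrow> ('n \<Rightarrow> 'n \<Rightarrow> bool) \<Rightarrow> (real ^ 'n ^ 'n) set"
  where "symmetric_edge_cone P G = {L \<in> \<C>. transpose L = L \<and> edge_cone P G L}"

lemma closed_symmetric_edge_cone:
  assumes "closed P" shows "closed (symmetric_edge_cone P G)"
proof -
  have eq: "symmetric_edge_cone P G = \<C> \<inter> {L. (\<forall>i j. L $ i $ j = L $ j $ i)
      \<and> (\<forall>i j. (G i j \<longrightarrow> L $ i $ j \<in> P) \<and> (i \<noteq> j \<longrightarrow> \<not> G i j \<longrightarrow> L $ i $ j = 0))}"
    by (auto simp: symmetric_edge_cone_def edge_cone_def transpose_self_iff)
  have "closed {L :: real ^ 'n ^ 'n. L $ i $ j \<in> P}" for i j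
    using continuous_closed_vimage[OF assms, of "\<lambda>L :: real ^ 'n ^ 'n. L $ i $ j"]
    by (simp add: vimage_def continuous_intros)
  then show ?thesis
    unfolding eq
    by (intro closed_Int closed_colour closed_Collect_conj closed_Collect_all closed_Collect_imp
        closed_Collect_eq open_Collect_const continuous_intros)
qed

text \<open>
  Separate the compact convex set of pairs \<open>(Y, \<langle>J, Y\<rangle>)\<close>, with \<open>Y\<close> a density matrix of the algebra,
  from the closed convex set of pairs \<open>(L, s)\<close>, with \<open>L\<close> in the cone that describes the sparsity and
  sign constraints and \<open>s \<ge> t\<close>; they are disjoint because \<open>t\<close> exceeds the optimum. After
  normalisation the separating functional is \<open>(W, 1)\<close>, where \<open>W\<close> is non-negative on the cone and
  \<open>\<langle>W, Y\<rangle> + \<langle>J, Y\<rangle> < t\<close> for all \<open>Y\<close>. Hence \<open>Z = t I - J - W\<close> is positive semidefinite, and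
  \<open>(Z + J) / (n t)\<close> is feasible for \<open>G\<close>. Attainment of the dual optimum is not part of the
  separation argument; it follows later by compactness.
\<close>

lemma approximate_strong_duality:
  fixes G :: "'n \<Rightarrow> 'n \<Rightarrow> bool"
  assumes G: "simple_graph G" and col: "\<And>i j k l. c i j = c k l \<Longrightarrow> G i j = G k l"
    and P: "closed P" "convex P" "0 \<in> P" "\<And>r p. p \<in> P \<Longrightarrow> 0 \<le> r \<Longrightarrow> r * p \<in> P"
    and Y\<^sub>0: "Y\<^sub>0 \<in> colour_densities" "edge_cone P G Y\<^sub>0"
    and max: "\<And>Y. Y \<in> colour_densities \<Longrightarrow> edge_cone P G Y \<Longrightarrow> 1 \<bullet> Y \<le> 1 \<bullet> Y\<^sub>0"
    and t: "1 \<bullet> Y\<^sub>0 < t"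
  shows "\<exists>X \<in> colour_densities. edge_polar P G X \<and> real CARD('n) \<le> (1 \<bullet> X) * t"
proof -
  define n where "n = real CARD('n)"
  have n: "n > 0" by (simp add: n_def)
  have sym: "G i j \<longleftrightarrow> G j i" and irr: "\<not> G i i" for i j
    using G by (auto simp: simple_graph_def symp_def irreflp_def)
  have "0 \<le> 1 \<bullet> Y\<^sub>0"
    using Y\<^sub>0 by (simp add: colour_densities_def density_matrix_inner_nonneg)
  then have "t > 0" using t by simp
  let ?L = "symmetric_edge_cone P G"
  let ?K = "(\<lambda>Y. (Y, 1 \<bullet> Y)) ` colour_densities"
  have scale_L: "r *\<^sub>R L \<in> ?L" if "L \<in> ?L" "0 \<le> r" for r L
    using that P(4) subspace_scale[OF subspace_colour]
    by (auto simp: symmetric_edge_cone_def edge_cone_def transpose_self_iff)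
  have add_P: "p + q \<in> P" if "p \<in> P" "q \<in> P" for p q
  proof -
    have "(1 / 2) *\<^sub>R p + (1 / 2) *\<^sub>R q \<in> P" using that by (intro convexD[OF P(2)]) auto
    from P(4)[OF this, of 2] show ?thesis by (simp add: algebra_simps)
  qed
  have add_L: "X + Y \<in> ?L" if "X \<in> ?L" "Y \<in> ?L" for X Y
    using that add_P subspace_add[OF subspace_colour]
    by (auto simp: symmetric_edge_cone_def edge_cone_def transpose_self_iff)
  have "convex ?L"
    unfolding convex_def
  proof (intro ballI allI impI)
    fix X Y and u v :: real
    assume "X \<in> ?L" "Y \<in> ?L" "0 \<le> u" "0 \<le> v"
    then have "u *\<^sub>R X \<in> ?L" "v *\<^sub>R Y \<in> ?L" using scale_L by auto
    then show "u *\<^sub>R X + v *\<^sub>R Y \<in> ?L" by (rule add_L)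
  qed
  then have "convex (?L \<times> {t..})" by (intro convex_Times convex_real_interval)
  moreover have "closed (?L \<times> {t..})"
    by (intro closed_Times closed_symmetric_edge_cone P closed_atLeast)
  moreover have "linear (\<lambda>Y :: real ^ 'n ^ 'n. (Y, 1 \<bullet> Y))"
    by (rule linearI) (simp_all add: inner_add_right)
  then have "convex ?K"
    using convex_linear_image convex_colour_densities by blast
  moreover have "compact ?K"
    by (intro compact_continuous_image compact_colour_densities continuous_intros)
  moreover have "?K \<noteq> {}" using Y\<^sub>0 by blast
  moreover have "?K \<inter> (?L \<times> {t..}) = {}"
    using max t by (force simp: symmetric_edge_cone_def)
  ultimately obtain z b where z: "\<forall>x\<in>?K. z \<bullet> x < b" "\<forall>x\<in>?L \<times> {t..}. b < z \<bullet> x"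
    using separating_hyperplane_compact_closed[of ?K "?L \<times> {t..}"] by blast
  obtain a \<gamma> where zp: "z = (a, \<gamma>)" by fastforce
  have K: "a \<bullet> Y + \<gamma> * (1 \<bullet> Y) < b" if "Y \<in> colour_densities" for Y
    using z(1) that by (auto simp: zp inner_Pair)
  have L: "b < a \<bullet> L + \<gamma> * t" if "L \<in> ?L" for L
    using z(2) that by (auto simp: zp inner_Pair)
  have Y\<^sub>0L: "Y\<^sub>0 \<in> ?L"
    using Y\<^sub>0 by (simp add: symmetric_edge_cone_def colour_densities_def density_matrix_def real_psd_def)
  \<comment> \<open>The feasible \<open>Y\<^sub>0\<close> lies on both sides, so the second coordinate alone separates it.\<close>
  have "0 < \<gamma> * (t - 1 \<bullet> Y\<^sub>0)"
    using K[OF Y\<^sub>0(1)] L[OF Y\<^sub>0L] by (simp add: right_diff_distrib)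
  then have \<gamma>: "\<gamma> > 0" using t by (simp add: zero_less_mult_iff)
  have b: "b < \<gamma> * t"
    using L[of 0] scale_L[OF Y\<^sub>0L, of 0] by simp
  have aL: "0 \<le> a \<bullet> L" if "L \<in> ?L" for L
  proof (rule ccontr)
    assume neg: "\<not> 0 \<le> a \<bullet> L"
    \<comment> \<open>The pair \<open>(r L, t)\<close> would lie on the separating hyperplane, yet \<open>r L\<close> is still in the cone.\<close>
    define r where "r = (b - \<gamma> * t) / (a \<bullet> L)"
    have "0 \<le> r" using neg b by (simp add: r_def divide_nonpos_neg)
    then have "b < a \<bullet> (r *\<^sub>R L) + \<gamma> * t" using L scale_L that by blast
    then show False using neg by (simp add: r_def)
  qed
  \<comment> \<open>The functional matters only on symmetric matrices of the algebra, so project it there.\<close>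
  define S where "S = {M \<in> \<C>. transpose M = M}"
  have "subspace S"
    using subspace_colour by (auto simp: S_def subspace_def transpose_self_iff)
  then have spanS: "span S = S" by (simp add: span_eq_iff)
  obtain W V where W: "W \<in> S" and V: "\<And>M. M \<in> S \<Longrightarrow> orthogonal V M" and a: "(1 / \<gamma>) *\<^sub>R a = W + V"
    using orthogonal_subspace_decomp_exists[of S "(1 / \<gamma>) *\<^sub>R a"] spanS by metis
  have WS: "W \<bullet> M = (1 / \<gamma>) * (a \<bullet> M)" if "M \<in> S" for M
  proof -
    have "(1 / \<gamma>) * (a \<bullet> M) = (W + V) \<bullet> M" by (simp flip: a)
    then show ?thesis using V[OF that] by (simp add: inner_add_left orthogonal_def)
  qed
  have LS: "?L \<subseteq> S" by (auto simp: symmetric_edge_cone_def S_def)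
  have WL: "0 \<le> W \<bullet> L" if "L \<in> ?L" for L
    using WS[of L] aL[OF that] LS that \<gamma> by auto
  \<comment> \<open>The cone leaves the diagonal free, so it contains both \<open>I\<close> and \<open>- I\<close>.\<close>
  have "s *\<^sub>R mat 1 \<in> ?L" for s :: real
    using irr P(3) subspace_scale[OF subspace_colour mat_1_colour, of s]
    by (auto simp: symmetric_edge_cone_def edge_cone_def transpose_self_iff mat_1_nth)
  from WL[OF this[of 1]] WL[OF this[of "-1"]] have "W \<bullet> mat 1 = 0" by simp
  then have "trace W = 0"
    using trace_mult_eq_inner[of W "mat 1"] W by (simp add: S_def)
  moreover have "regular_matrix W" using W by (simp add: S_def regular_matrix_colour)
  ultimately have W_diag: "W $ i $ i = 0" for i
    using trace_constant_diagonal[of W i] by (auto simp: regular_matrix_def)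
  have W_edge: "0 \<le> W $ i $ j * p" if "G i j" "p \<in> P" for i j p
  proof -
    \<comment> \<open>Test \<open>W\<close> against the symmetrised indicator of the colour class of the edge.\<close>
    define h where "h k l = (if c k l = c i j then 1 else 0) + (if c l k = c i j then 1 else 0 :: real)" for k l
    define H where "H = (\<chi> k l. h k l * p)"
    have h_colour: "h k l = h k' l'" if "c k l = c k' l'" for k l k' l'
      using colour_transpose[OF that] that by (simp add: h_def)
    have h_sym: "h k l = h l k" and h_nonneg: "0 \<le> h k l" for k l by (auto simp: h_def)
    have h_zero: "h k l = 0" if "\<not> G k l" for k l
    proof -
      have "c k l \<noteq> c i j" "c l k \<noteq> c i j"
        using that \<open>G i j\<close> col sym by metis+
      then show ?thesis by (simp add: h_def)
    qed
    have "H \<in> \<C>"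
    proof (rule colour_algebraI)
      fix k l k' l' assume "c k l = c k' l'"
      from h_colour[OF this] show "H $ k $ l = H $ k' $ l'" by (simp add: H_def)
    qed
    moreover have "transpose H = H" using h_sym by (simp add: transpose_self_iff H_def)
    moreover have "edge_cone P G H"
      using P(4)[OF \<open>p \<in> P\<close> h_nonneg] h_zero by (auto simp: edge_cone_def H_def)
    ultimately have "H \<in> ?L" by (simp add: symmetric_edge_cone_def)
    have "W $ k $ l * h k l = W $ i $ j * h k l" for k l
    proof -
      have W': "W \<in> \<C>" "transpose W = W" using W by (simp_all add: S_def)
      have "W $ k $ l = W $ i $ j" if "c k l = c i j \<or> c l k = c i j"
        using that colour_algebraD[OF W'(1), of k l i j] colour_algebraD[OF W'(1), of l k i j] W'(2)
        by (metis transpose_self_iff)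
      then show ?thesis by (auto simp: h_def)
    qed
    then have entry: "W $ k $ l * (h k l * p) = (W $ i $ j * p) * h k l" for k l
      by (metis mult.assoc mult.commute)
    have "W \<bullet> H = (\<Sum>k\<in>UNIV. \<Sum>l\<in>UNIV. W $ k $ l * (h k l * p))"
      by (simp add: inner_matrix_eq_sum H_def)
    then have "W \<bullet> H = (W $ i $ j * p) * (\<Sum>k\<in>UNIV. \<Sum>l\<in>UNIV. h k l)"
      unfolding entry sum_distrib_left .
    moreover have "0 < (\<Sum>k\<in>UNIV. \<Sum>l\<in>UNIV. h k l)"
    proof -
      have "1 \<le> h i j" "\<And>k l. 0 \<le> h k l" by (auto simp: h_def)
      moreover have "h i j \<le> (\<Sum>l\<in>UNIV. h i l)"
        using calculation(2) by (intro member_le_sum) auto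
      moreover have "(\<Sum>l\<in>UNIV. h i l) \<le> (\<Sum>k\<in>UNIV. \<Sum>l\<in>UNIV. h k l)"
        using calculation(2) by (intro member_le_sum[of i UNIV "\<lambda>k. \<Sum>l\<in>UNIV. h k l"] sum_nonneg) auto
      ultimately show ?thesis by linarith
    qed
    ultimately show ?thesis
      using WL[OF \<open>H \<in> ?L\<close>] by (simp add: zero_le_mult_iff)
  qed
  define Z where "Z = t *\<^sub>R mat 1 - 1 - W"
  have "Z \<in> \<C>" "transpose Z = Z"
    using W subspace_colour mat_1_colour all_ones_colour
    by (auto simp: Z_def S_def transpose_self_iff mat_1_nth intro!: subspace_diff subspace_scale)
  moreover have "0 \<le> Z \<bullet> Y" if "Y \<in> colour_densities" for Y
  proof -
    have "Y \<in> S" "trace Y = 1"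
      using that by (simp_all add: S_def colour_densities_def density_matrix_def real_psd_def)
    have "mat 1 \<bullet> Y = trace Y"
      using trace_mult_eq_inner[of "mat 1" Y] by (simp add: transpose_mat)
    moreover have "W \<bullet> Y + 1 \<bullet> Y = (a \<bullet> Y + \<gamma> * (1 \<bullet> Y)) / \<gamma>"
      using WS[OF \<open>Y \<in> S\<close>] \<gamma> by (simp add: add_divide_distrib)
    moreover have "(a \<bullet> Y + \<gamma> * (1 \<bullet> Y)) / \<gamma> < t"
      using K[OF that] b \<gamma> by (simp add: divide_less_eq mult.commute)
    ultimately show ?thesis
      using \<open>trace Y = 1\<close> by (simp add: Z_def inner_diff_left)
  qed
  ultimately have Z: "Z \<in> \<C>" "real_psd Z"
    using psd_of_nonneg_on_densities by blast+
  define X where "X = (1 / (n * t)) *\<^sub>R (Z + 1)"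
  have X_nth: "X $ i $ j = ((if i = j then t else 0) - W $ i $ j) / (n * t)" for i j
    by (simp add: X_def Z_def mat_1_nth)
  have "trace X = 1"
    using n \<open>t > 0\<close> by (simp add: trace_def X_nth W_diag n_def)
  then have "X \<in> colour_densities"
    using Z n \<open>t > 0\<close> subspace_colour all_ones_colour
    by (auto simp: colour_densities_def density_matrix_def X_def
        intro!: real_psd_scale real_psd_add real_psd_all_ones subspace_add subspace_scale)
  moreover have "edge_polar P G X"
    unfolding edge_polar_def
  proof (intro allI impI ballI)
    fix i j p assume "G i j" "p \<in> P"
    then have "i \<noteq> j" using irr by auto
    then have "X $ i $ j * p = - (W $ i $ j * p) / (n * t)" by (simp add: X_nth)
    then show "X $ i $ j * p \<le> 0"
      using W_edge[OF \<open>G i j\<close> \<open>p \<in> P\<close>] n \<open>t > 0\<close> by simp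
  qed
  moreover have "n \<le> (1 \<bullet> X) * t"
  proof -
    have "(1 :: real ^ 'n ^ 'n) \<bullet> 1 = n * n" by (simp add: all_ones_inner n_def)
    moreover have "0 \<le> 1 \<bullet> Z" using Z inner_real_psd_nonneg real_psd_all_ones by blast
    ultimately show ?thesis
      using n \<open>t > 0\<close> by (simp add: X_def inner_add_right divide_simps)
  qed
  ultimately show ?thesis unfolding n_def by blast
qed

text \<open>
  Both programs, restricted to the algebra, have compact feasible sets and so attain their optima.
  The approximate duality for every \<open>t\<close> above the maximum of one gives that the product of the
  optima is at least \<open>n\<close>; weak duality gives the reverse inequality.
\<close>

lemma colour_dual_certificate:
  fixes G :: "'n \<Rightarrow> 'n \<Rightarrow> bool"
  assumes G: "simple_graph G" and col: "\<And>i j k l. c i j = c k l \<Longrightarrow> G i j = G k l"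
    and P: "closed P" "convex P" "0 \<in> P" "\<And>r p. p \<in> P \<Longrightarrow> 0 \<le> r \<Longrightarrow> r * p \<in> P"
  shows "\<exists>X Y. dual_certificate P G X Y"
proof -
  define n where "n = real CARD('n)"
  have n: "n > 0" by (simp add: n_def)
  define KY where "KY = colour_densities \<inter> symmetric_edge_cone P G"
  define KX where "KX = colour_densities \<inter> {X. edge_polar P G X}"
  have KY_iff: "Y \<in> KY \<longleftrightarrow> Y \<in> colour_densities \<and> edge_cone P G Y" for Y
    by (auto simp: KY_def symmetric_edge_cone_def colour_densities_def density_matrix_def real_psd_def)
  have "compact KY"
    unfolding KY_def by (intro compact_Int_closed compact_colour_densities closed_symmetric_edge_cone P)
  moreover have U: "(1 / n) *\<^sub>R mat 1 \<in> KY"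
    using uniform_colour_density G P(3)
    by (auto simp: KY_iff edge_cone_def mat_1_nth n_def simple_graph_def irreflp_def)
  moreover have cont: "continuous_on A (\<lambda>Y :: real ^ 'n ^ 'n. 1 \<bullet> Y)" for A
    by (intro continuous_intros)
  ultimately obtain Y\<^sub>0 where Y\<^sub>0: "Y\<^sub>0 \<in> KY" "\<And>Y. Y \<in> KY \<Longrightarrow> 1 \<bullet> Y \<le> 1 \<bullet> Y\<^sub>0"
    using continuous_attains_sup[of KY "\<lambda>Y. 1 \<bullet> Y"] by blast
  define \<nu> where "\<nu> = 1 \<bullet> Y\<^sub>0"
  have "(1 :: real ^ 'n ^ 'n) \<bullet> mat 1 = n"
    by (simp add: all_ones_inner mat_1_nth n_def)
  then have "1 \<le> \<nu>" using Y\<^sub>0(2)[OF U] n by (simp add: \<nu>_def)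
  have step: "\<exists>X \<in> KX. n \<le> (1 \<bullet> X) * t" if "\<nu> < t" for t
    using approximate_strong_duality[OF G col P, of Y\<^sub>0 t] Y\<^sub>0 that
    by (auto simp: KX_def KY_iff n_def \<nu>_def)
  have "closed {X :: real ^ 'n ^ 'n. edge_polar P G X}"
    unfolding edge_polar_def Ball_def
    by (intro closed_Collect_all closed_Collect_imp closed_Collect_le open_Collect_const continuous_intros)
  then have "compact KX"
    unfolding KX_def by (intro compact_Int_closed compact_colour_densities)
  moreover have "KX \<noteq> {}" using step[of "\<nu> + 1"] by auto
  ultimately obtain X\<^sub>0 where X\<^sub>0: "X\<^sub>0 \<in> KX" "\<And>X. X \<in> KX \<Longrightarrow> 1 \<bullet> X \<le> 1 \<bullet> X\<^sub>0"
    using continuous_attains_sup[of KX "\<lambda>Y. 1 \<bullet> Y"] cont by blast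
  have ge: "n \<le> (1 \<bullet> X\<^sub>0) * t" if t: "\<nu> < t" for t
  proof -
    obtain X where "X \<in> KX" "n \<le> (1 \<bullet> X) * t" using step[OF t] by blast
    moreover have "0 \<le> t" using t \<open>1 \<le> \<nu>\<close> by simp
    ultimately show ?thesis using X\<^sub>0(2) by (meson mult_right_mono order_trans)
  qed
  have "0 \<le> 1 \<bullet> X\<^sub>0"
    using X\<^sub>0 by (simp add: KX_def colour_densities_def density_matrix_inner_nonneg)
  moreover have "1 \<bullet> X\<^sub>0 \<noteq> 0" using ge[of "\<nu> + 1"] n by auto
  ultimately have \<mu>: "0 < 1 \<bullet> X\<^sub>0" by simp
  have "n / (1 \<bullet> X\<^sub>0) \<le> \<nu>"
  proof (rule dense_ge)
    fix t assume "\<nu> < t"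
    from ge[OF this] show "n / (1 \<bullet> X\<^sub>0) \<le> t" using \<mu> by (simp add: divide_le_eq mult.commute)
  qed
  then have "n \<le> (1 \<bullet> X\<^sub>0) * \<nu>" using \<mu> by (simp add: divide_le_eq mult.commute)
  moreover have D: "density_matrix X\<^sub>0" "edge_polar P G X\<^sub>0" "density_matrix Y\<^sub>0" "edge_cone P G Y\<^sub>0"
    "regular_matrix X\<^sub>0" "regular_matrix Y\<^sub>0"
    using X\<^sub>0 Y\<^sub>0(1) by (auto simp: KX_def KY_iff colour_densities_def regular_matrix_colour)
  then have "(1 \<bullet> X\<^sub>0) * \<nu> \<le> n"
    unfolding \<nu>_def n_def by (intro edge_weak_duality) auto
  ultimately show ?thesis
    using D unfolding dual_certificate_def n_def \<nu>_def by (metis order_antisym)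
qed

end


text \<open>
  The matrices of the configuration have entries in \<open>{0, 1}\<close> and sum to \<open>J\<close>, so exactly one of
  them is non-zero at each position; it is the colour of that position. Closure of the colour
  algebra under multiplication follows from bilinearity, after expanding both factors in the
  configuration.
\<close>

lemma coherent_configuration_dual_certificate:
  fixes G :: "'n::finite \<Rightarrow> 'n \<Rightarrow> bool"
  assumes G: "simple_graph G"
    and cc: "coherent_configuration \<A>" "homogeneous \<A>" "belongs_to G \<A>"
    and P: "closed P" "convex P" "0 \<in> P" "\<And>r p. p \<in> P \<Longrightarrow> 0 \<le> r \<Longrightarrow> r * p \<in> P"
  shows "\<exists>X Y. dual_certificate P G X Y"
proof -
  define c where "c i j = {B \<in> \<A>. B $ i $ j = 1}" for i j
  have fin: "finite \<A>" and one: "mat 1 \<in> \<A>"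
    using cc by (auto simp: coherent_configuration_def homogeneous_def)
  have entry: "B $ i $ j = (if B \<in> c i j then 1 else 0)" if "B \<in> \<A>" for B i j
    using cc(1) that by (auto simp: coherent_configuration_def zero_one_matrix_def c_def)
  have "\<exists>B. c i j = {B}" for i j
  proof -
    have sub: "c i j \<subseteq> \<A>" by (auto simp: c_def)
    have "(\<Sum>B\<in>\<A>. B) $ i $ j = 1"
      using cc(1) by (simp add: coherent_configuration_def)
    then have "(\<Sum>B\<in>\<A>. if B \<in> c i j then 1 else 0 :: complex) = 1"
      using entry by (simp add: sum_component)
    moreover have "(\<Sum>B\<in>\<A>. if B \<in> c i j then 1 else 0 :: complex) = of_nat (card (c i j))"
      using fin sub by (simp add: sum.If_cases Int_absorb1)
    ultimately have "card (c i j) = 1" by (metis of_nat_eq_1_iff)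
    then show ?thesis by (simp add: card_1_singleton_iff)
  qed
  then obtain b where b: "c i j = {b i j}" for i j by metis
  have bA: "b i j \<in> \<A>" for i j
    using b[of i j] by (auto simp: c_def)
  have diag: "c i i = {mat 1}" for i
  proof -
    have "mat 1 \<in> c i i" using one by (simp add: c_def mat_1_nth)
    then show ?thesis by (simp add: b)
  qed
  interpret homogeneous_colouring c
  proof
    fix i j k l
    show "c i i = c k k" by (simp add: diag)
    show "k = l" if "c i i = c k l"
    proof -
      have "mat 1 \<in> c k l" using that diag by auto
      then show ?thesis by (simp add: c_def mat_1_nth split: if_splits)
    qed
    show "c j i = c l k" if "c i j = c k l"
    proof -
      have "B \<in> c q p \<longleftrightarrow> B \<in> \<A> \<and> transpose B \<in> c p q" for B p q
        using cc(1) by (auto simp: c_def coherent_configuration_def transpose_def)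
      then show ?thesis using that by blast
    qed
  next
    fix M N assume M: "M \<in> colour_algebra c" and N: "N \<in> colour_algebra c"
    have expand: "\<exists>m. \<forall>i j. complex_of_real (M $ i $ j) = (\<Sum>B\<in>\<A>. m B * B $ i $ j)"
      if "M \<in> colour_algebra c" for M
    proof -
      \<comment> \<open>The coefficient of \<open>B\<close> is the entry of \<open>M\<close> at any position of colour \<open>B\<close>.\<close>
      define m where "m B = complex_of_real (SOME x. \<exists>i j. b i j = B \<and> M $ i $ j = x)" for B
      have "(SOME x. \<exists>k l. b k l = b i j \<and> M $ k $ l = x) = M $ i $ j" for i j
      proof (rule some_equality)
        show "x = M $ i $ j" if "\<exists>k l. b k l = b i j \<and> M $ k $ l = x" for x
          using that colour_algebraD[OF \<open>M \<in> colour_algebra c\<close>] b by metis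
      qed blast
      then have "complex_of_real (M $ i $ j) = m (b i j)" for i j by (simp add: m_def)
      also have "m (b i j) = (\<Sum>B\<in>\<A>. if B = b i j then m B else 0)" for i j
        using fin bA by simp
      also have "\<dots> i j = (\<Sum>B\<in>\<A>. m B * B $ i $ j)" for i j
        using entry b by (intro sum.cong) auto
      finally show ?thesis by blast
    qed
    obtain m where m: "\<And>i j. complex_of_real (M $ i $ j) = (\<Sum>B\<in>\<A>. m B * B $ i $ j)"
      using expand[OF M] by blast
    obtain n where n: "\<And>i j. complex_of_real (N $ i $ j) = (\<Sum>B\<in>\<A>. n B * B $ i $ j)"
      using expand[OF N] by blast
    have prod: "complex_of_real ((M ** N) $ i $ j) = (\<Sum>B\<in>\<A>. \<Sum>C\<in>\<A>. m B * n C * (B ** C) $ i $ j)" for i j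
    proof -
      have "complex_of_real ((M ** N) $ i $ j)
          = (\<Sum>k\<in>UNIV. (\<Sum>B\<in>\<A>. m B * B $ i $ k) * (\<Sum>C\<in>\<A>. n C * C $ k $ j))"
        by (simp add: matrix_matrix_mult_def m n)
      also have "\<dots> = (\<Sum>k\<in>UNIV. \<Sum>B\<in>\<A>. \<Sum>C\<in>\<A>. m B * n C * (B $ i $ k * C $ k $ j))"
        by (simp add: sum_product mult_ac)
      also have "\<dots> = (\<Sum>B\<in>\<A>. \<Sum>k\<in>UNIV. \<Sum>C\<in>\<A>. m B * n C * (B $ i $ k * C $ k $ j))"
        by (rule sum.swap)
      also have "\<dots> = (\<Sum>B\<in>\<A>. \<Sum>C\<in>\<A>. \<Sum>k\<in>UNIV. m B * n C * (B $ i $ k * C $ k $ j))"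
        by (intro sum.cong refl sum.swap)
      also have "\<dots> = (\<Sum>B\<in>\<A>. \<Sum>C\<in>\<A>. m B * n C * (B ** C) $ i $ j)"
        by (simp add: matrix_matrix_mult_def sum_distrib_left)
      finally show ?thesis .
    qed
    show "M ** N \<in> colour_algebra c"
    proof (rule colour_algebraI)
      fix i j k l assume eq: "c i j = c k l"
      have "(B ** C) $ i $ j = (B ** C) $ k $ l" if BC: "B \<in> \<A>" "C \<in> \<A>" for B C
      proof -
        obtain d where d: "B ** C = (\<Sum>K\<in>\<A>. d K *\<^sub>M K)"
          using cc(1) BC by (force simp: coherent_configuration_def)
        have "(d K *\<^sub>M K) $ i $ j = (d K *\<^sub>M K) $ k $ l" if "K \<in> \<A>" for K
          using entry[OF that, of i j] entry[OF that, of k l] eq by (simp add: smult_matrix_def)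
        then show ?thesis by (simp add: d sum_component)
      qed
      then have "complex_of_real ((M ** N) $ i $ j) = complex_of_real ((M ** N) $ k $ l)"
        unfolding prod by (intro sum.cong refl) simp
      then show "(M ** N) $ i $ j = (M ** N) $ k $ l" unfolding of_real_eq_iff .
    qed
  qed
  have "G i j = G k l" if eq: "c i j = c k l" for i j k l
  proof -
    obtain \<B> where \<B>: "\<B> \<subseteq> \<A>" "adj_matrix G = (\<Sum>M\<in>\<B>. M)"
      using cc(3) by (auto simp: belongs_to_def)
    have "B $ i $ j = B $ k $ l" if "B \<in> \<B>" for B
      using entry[of B i j] entry[of B k l] that \<B>(1) eq by auto
    then have "adj_matrix G $ i $ j = adj_matrix G $ k $ l"
      by (simp add: \<B>(2) sum_component)
    then show ?thesis by (simp add: adj_matrix_def split: if_splits)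
  qed
  then show ?thesis using colour_dual_certificate[OF G _ P] by blast
qed

section \<open>From real to complex matrices\<close>

definition Re_matrix :: "'n::finite cmatrix \<Rightarrow> real ^ 'n ^ 'n"
  where "Re_matrix X = (\<chi> i j. Re (X $ i $ j))"

definition complex_matrix :: "real ^ 'n ^ 'n \<Rightarrow> 'n::finite cmatrix"
  where "complex_matrix M = (\<chi> i j. complex_of_real (M $ i $ j))"

lemma Re_matrix_nth [simp]: "Re_matrix X $ i $ j = Re (X $ i $ j)"
  by (simp add: Re_matrix_def)

lemma complex_matrix_nth [simp]: "complex_matrix M $ i $ j = complex_of_real (M $ i $ j)"
  by (simp add: complex_matrix_def)

text \<open>
  Evaluate the Hermitian form at real vectors.
\<close>

lemma real_psd_Re_matrix:
  assumes "pos_semidef X" shows "real_psd (Re_matrix X)"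
proof -
  have herm: "cnj (X $ j $ i) = X $ i $ j" for i j
    using assms by (auto simp: pos_semidef_def hermitian_def ctranspose_def vec_eq_iff)
  have "0 \<le> v \<bullet> (Re_matrix X *v v)" for v
  proof -
    have "0 \<le> (\<Sum>i\<in>UNIV. cnj ((\<chi> i. complex_of_real (v $ i)) $ i) * (X *v (\<chi> i. complex_of_real (v $ i))) $ i)"
      using assms by (simp only: pos_semidef_def)
    then have "0 \<le> Re (\<Sum>i\<in>UNIV. cnj ((\<chi> i. complex_of_real (v $ i)) $ i) * (X *v (\<chi> i. complex_of_real (v $ i))) $ i)"
      by (simp only: less_eq_complex_def zero_complex.sel)
    then show ?thesis
      unfolding inner_matrix_vector_eq_sum
      by (simp add: matrix_vector_mult_def sum_distrib_left mult.assoc)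
  qed
  moreover have "Re (X $ i $ j) = Re (X $ j $ i)" for i j
    by (metis complex_cnj(1) herm complex.sel(1) cnj.simps(1))
  ultimately show ?thesis by (simp add: real_psd_def transpose_self_iff)
qed

text \<open>
  Split a complex vector as \<open>x + \<i> y\<close>: the mixed terms cancel by symmetry.
\<close>

lemma pos_semidef_complex_matrix:
  assumes "real_psd M" shows "pos_semidef (complex_matrix M)"
proof -
  have "0 \<le> (\<Sum>i\<in>UNIV. cnj (v $ i) * (complex_matrix M *v v) $ i)" for v
  proof -
    define x y :: "real ^ 'a" where "x = (\<chi> i. Re (v $ i))" and "y = (\<chi> i. Im (v $ i))"
    let ?s = "\<Sum>i\<in>UNIV. cnj (v $ i) * (complex_matrix M *v v) $ i"
    have "Re ?s = x \<bullet> (M *v x) + y \<bullet> (M *v y)"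
      unfolding inner_matrix_vector_eq_sum
      by (simp add: matrix_vector_mult_def x_def y_def sum_distrib_left sum.distrib [symmetric] algebra_simps)
    moreover have "Im ?s = x \<bullet> (M *v y) - y \<bullet> (M *v x)"
      unfolding inner_matrix_vector_eq_sum
      by (simp add: matrix_vector_mult_def x_def y_def sum_distrib_left sum_subtractf [symmetric] algebra_simps)
    moreover have "x \<bullet> (M *v y) = y \<bullet> (M *v x)"
      using assms by (intro symmetric_inner_swap) (simp add: real_psd_def)
    ultimately show ?thesis
      using assms by (simp add: less_eq_complex_def real_psd_def)
  qed
  moreover have "hermitian (complex_matrix M)"
    using real_psd_symD[OF assms] by (auto simp: hermitian_def ctranspose_def vec_eq_iff)
  ultimately show ?thesis by (simp add: pos_semidef_def)
qed

lemma matrix_inner_all_ones: "matrix_inner all_ones X = (\<Sum>i\<in>UNIV. \<Sum>j\<in>UNIV. cnj (X $ i $ j))"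
  by (simp add: matrix_inner_def trace_def matrix_matrix_mult_def ctranspose_def)

lemma density_matrix_Re_matrix:
  assumes "pos_semidef X" "trace X = 1" shows "density_matrix (Re_matrix X)"
proof -
  have "trace (Re_matrix X) = Re (trace X)" by (simp add: trace_def)
  then show ?thesis using assms by (simp add: density_matrix_def real_psd_Re_matrix)
qed

lemma density_matrix_complex_matrix:
  assumes "density_matrix M" shows "pos_semidef (complex_matrix M) \<and> trace (complex_matrix M) = 1"
proof -
  have "trace (complex_matrix M) = complex_of_real (trace M)" by (simp add: trace_def)
  then show ?thesis using assms by (simp add: density_matrix_def pos_semidef_complex_matrix)
qed

text \<open>
  The constraints and the objective are compatible with taking real parts, so each maximum over
  complex matrices is a maximum over real symmetric ones.
\<close>

lemma Greatest_via_real_matrices: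
  assumes max: "F M\<^sub>0" "\<And>M. F M \<Longrightarrow> 1 \<bullet> M \<le> 1 \<bullet> M\<^sub>0"
    and to_complex: "\<And>M. F M \<Longrightarrow> Q (complex_matrix M)"
    and to_real: "\<And>X. Q X \<Longrightarrow> F (Re_matrix X)"
  shows "(GREATEST t. \<exists>X. complex_of_real t = matrix_inner all_ones X \<and> Q X) = 1 \<bullet> M\<^sub>0"
proof (rule Greatest_equality)
  have "complex_of_real (1 \<bullet> M\<^sub>0) = matrix_inner all_ones (complex_matrix M\<^sub>0)"
    by (simp add: matrix_inner_all_ones all_ones_inner)
  then show "\<exists>X. complex_of_real (1 \<bullet> M\<^sub>0) = matrix_inner all_ones X \<and> Q X"
    using to_complex[OF max(1)] by blast
next
  fix t assume "\<exists>X. complex_of_real t = matrix_inner all_ones X \<and> Q X"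
  then obtain X where X: "complex_of_real t = matrix_inner all_ones X" "Q X" by blast
  have "t = Re (matrix_inner all_ones X)" by (metis X(1) Re_complex_of_real)
  also have "\<dots> = 1 \<bullet> Re_matrix X" by (simp add: matrix_inner_all_ones all_ones_inner)
  also have "\<dots> \<le> 1 \<bullet> M\<^sub>0" using X(2) to_real max(2) by blast
  finally show "t \<le> 1 \<bullet> M\<^sub>0" .
qed

lemma edge_polar_UNIV: "edge_polar UNIV G M \<longleftrightarrow> (\<forall>i j. G i j \<longrightarrow> M $ i $ j = 0)"
proof -
  have "(\<forall>p\<in>UNIV. x * p \<le> 0) \<longleftrightarrow> x = 0" for x :: real
  proof
    assume "\<forall>p\<in>UNIV. x * p \<le> 0"
    from bspec[OF this, of x] show "x = 0" by (auto simp: mult_le_0_iff)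
  qed simp
  then show ?thesis by (simp only: edge_polar_def)
qed

lemma edge_polar_nonneg: "edge_polar {0..} G M \<longleftrightarrow> (\<forall>i j. G i j \<longrightarrow> M $ i $ j \<le> 0)"
proof -
  have "(\<forall>p\<in>{0..}. x * p \<le> 0) \<longleftrightarrow> x \<le> 0" for x :: real
  proof
    assume "\<forall>p\<in>{0..}. x * p \<le> 0"
    from bspec[OF this, of 1] show "x \<le> 0" by simp
  qed (simp add: mult_nonpos_nonneg)
  then show ?thesis by (simp only: edge_polar_def)
qed

lemma schur_adj_eq_0_iff: "X \<circ>\<^sub>S adj_matrix G = 0 \<longleftrightarrow> (\<forall>i j. G i j \<longrightarrow> X $ i $ j = 0)"
  by (auto simp: vec_eq_iff adj_matrix_def)

lemma schur_adj_nonpos_iff: "X \<circ>\<^sub>S adj_matrix G \<le> 0 \<longleftrightarrow> (\<forall>i j. G i j \<longrightarrow> X $ i $ j \<le> 0)"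
  by (auto simp: nonpos_matrix_iff adj_matrix_def)

lemma theta_eq_of_dual_certificate_UNIV:
  assumes "dual_certificate UNIV G X Y"
  shows "lovasz_theta G = 1 \<bullet> X" and "lovasz_theta (graph_complement G) = 1 \<bullet> Y"
proof -
  note opt = dual_certificate_optimal[OF assms]
  show "lovasz_theta G = 1 \<bullet> X"
    unfolding lovasz_theta_def
  proof (rule Greatest_via_real_matrices[where F = "\<lambda>M. density_matrix M \<and> edge_polar UNIV G M"])
    show "density_matrix X \<and> edge_polar UNIV G X"
      using assms by (simp add: dual_certificate_def)
  qed (use opt in \<open>auto simp: edge_polar_UNIV schur_adj_eq_0_iff density_matrix_Re_matrix
        density_matrix_complex_matrix\<close>)
  show "lovasz_theta (graph_complement G) = 1 \<bullet> Y"
    unfolding lovasz_theta_def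
  proof (rule Greatest_via_real_matrices[where F = "\<lambda>M. density_matrix M \<and> edge_cone UNIV G M"])
    show "density_matrix Y \<and> edge_cone UNIV G Y"
      using assms by (simp add: dual_certificate_def)
  qed (use opt in \<open>auto simp: edge_cone_def graph_complement_def schur_adj_eq_0_iff
        density_matrix_Re_matrix density_matrix_complex_matrix\<close>)
qed

lemma theta_eq_of_dual_certificate_nonneg:
  assumes "dual_certificate {0..} G X Y"
  shows "szegedy_theta G = 1 \<bullet> X" and "schrijver_theta (graph_complement G) = 1 \<bullet> Y"
proof -
  note opt = dual_certificate_optimal[OF assms]
  show "szegedy_theta G = 1 \<bullet> X"
    unfolding szegedy_theta_def
  proof (rule Greatest_via_real_matrices[where F = "\<lambda>M. density_matrix M \<and> edge_polar {0..} G M"])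
    show "density_matrix X \<and> edge_polar {0..} G X"
      using assms by (simp add: dual_certificate_def)
  qed (use opt in \<open>auto simp: edge_polar_nonneg schur_adj_nonpos_iff density_matrix_Re_matrix
        density_matrix_complex_matrix less_eq_complex_def\<close>)
  show "schrijver_theta (graph_complement G) = 1 \<bullet> Y"
    unfolding schrijver_theta_def
  proof (rule Greatest_via_real_matrices[where F = "\<lambda>M. density_matrix M \<and> edge_cone {0..} G M"])
    show "density_matrix Y \<and> edge_cone {0..} G Y"
      using assms by (simp add: dual_certificate_def)
  next
    fix M :: "real ^ 'a ^ 'a" assume M: "density_matrix M \<and> edge_cone {0..} G M"
    then have "0 \<le> M $ i $ j" for i j
      using real_psd_diag[of M i]
      by (cases "i = j"; cases "G i j") (auto simp: density_matrix_def edge_cone_def)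
    then show "complex_matrix M \<circ>\<^sub>S adj_matrix (graph_complement G) = 0 \<and>
        trace (complex_matrix M) = 1 \<and> 0 \<le> complex_matrix M \<and> pos_semidef (complex_matrix M)"
      using M density_matrix_complex_matrix[of M]
      by (auto simp: edge_cone_def graph_complement_def schur_adj_eq_0_iff nonneg_matrix_iff
          less_eq_complex_def)
  qed (use opt in \<open>auto simp: edge_cone_def graph_complement_def schur_adj_eq_0_iff nonneg_matrix_iff
        density_matrix_Re_matrix less_eq_complex_def\<close>)
qed

theorem corollary10:
  fixes G :: "'n::finite \<Rightarrow> 'n \<Rightarrow> bool"
  assumes "simple_graph G"
    and "(\<exists>\<A>. coherent_configuration \<A> \<and> homogeneous \<A> \<and> belongs_to G \<A>) \<or> one_walk_regular G"
  shows "lovasz_theta G * lovasz_theta (graph_complement G) = real CARD('n)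
    \<and> schrijver_theta (graph_complement G) * szegedy_theta G = real CARD('n)"
proof -
  have certificate: "\<exists>X Y. dual_certificate P G X Y"
    if P: "closed P" "convex P" "{0..} \<subseteq> P" "\<And>r p. p \<in> P \<Longrightarrow> 0 \<le> r \<Longrightarrow> r * p \<in> P" for P
    using assms(2)
  proof
    assume "\<exists>\<A>. coherent_configuration \<A> \<and> homogeneous \<A> \<and> belongs_to G \<A>"
    then show ?thesis
      using coherent_configuration_dual_certificate[OF assms(1) _ _ _ P(1,2) _ P(4)] P(3) by auto
  next
    assume "one_walk_regular G"
    then show ?thesis using one_walk_regular_dual_certificate assms(1) P(3) by blast
  qed
  obtain X Y where XY: "dual_certificate UNIV G X Y"
    using certificate[of UNIV] by auto
  obtain X' Y' where XY': "dual_certificate {0..} G X' Y'"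
    using certificate[of "{0..}"] by (auto simp: convex_real_interval)
  show ?thesis
    using XY XY' by (simp add: theta_eq_of_dual_certificate_UNIV[OF XY]
        theta_eq_of_dual_certificate_nonneg[OF XY'] dual_certificate_def mult.commute)
qed

end
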